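(* For each integer $g\geq 8$, there are infinitely many Nielsen equivalence classes of generating pairs of the integral symplectic group $\mathrm{Sp}(2g,\mathbb{Z})$.
   Context: A generating pair of a group $G$ is a pair $(x_1,x_2)$ of elements of $G$ such that $x_1,x_2$ generate $G$. An elementary Nielsen transformation on a $k$-tuple $(x_1,\ldots,x_k)$ of elements of $G$ is one of the following operations: (1) replace $x_i$ by $x_i^{-1}$ for some $i$; (2) swap $x_i$ and $x_j$ for some $i\neq j$; (3) replace $x_i$ by $x_ix_j$ for some $i\neq j$. Two $k$-tuples are Nielsen equivalent if one can be transformed into the other by a finite sequence of elementary Nielsen transformations. *)

theory Defs
  imports "HOL-Algebra.Generated_Groups" "Jordan_Normal_Form.Matrix"
begin

section \<open>Nielsen equivalence\<close>

text \<open>A \<open>k\<close>-tuple of elements of \<open>G\<close> is a list of length \<open>k\<close>; positions are counted from 0.\<close>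

inductive elementary_nielsen :: "('a, 'b) monoid_scheme \<Rightarrow> 'a list \<Rightarrow> 'a list \<Rightarrow> bool"
  for G (structure) where
  invert: "\<lbrakk>set xs \<subseteq> carrier G; i < length xs\<rbrakk>
    \<Longrightarrow> elementary_nielsen G xs (xs[i := inv (xs ! i)])"
| swap: "\<lbrakk>set xs \<subseteq> carrier G; i < length xs; j < length xs; i \<noteq> j\<rbrakk>
    \<Longrightarrow> elementary_nielsen G xs (xs[i := xs ! j, j := xs ! i])"
| mult: "\<lbrakk>set xs \<subseteq> carrier G; i < length xs; j < length xs; i \<noteq> j\<rbrakk>
    \<Longrightarrow> elementary_nielsen G xs (xs[i := xs ! i \<otimes> xs ! j])"

definition nielsen_equivalent :: "('a, 'b) monoid_scheme \<Rightarrow> 'a list \<Rightarrow> 'a list \<Rightarrow> bool" where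
  "nielsen_equivalent G = (elementary_nielsen G)\<^sup>*\<^sup>*"

definition generating_pairs :: "('a, 'b) monoid_scheme \<Rightarrow> 'a list set" where
  "generating_pairs G = {[x\<^sub>1, x\<^sub>2] | x\<^sub>1 x\<^sub>2.
     x\<^sub>1 \<in> carrier G \<and> x\<^sub>2 \<in> carrier G \<and> generate G {x\<^sub>1, x\<^sub>2} = carrier G}"

definition nielsen_classes_of_pairs :: "('a, 'b) monoid_scheme \<Rightarrow> 'a list set set" where
  "nielsen_classes_of_pairs G = generating_pairs G //
     {(xs, ys). xs \<in> generating_pairs G \<and> ys \<in> generating_pairs G \<and> nielsen_equivalent G xs ys}"

section \<open>The integral symplectic group\<close>

definition symplectic_form :: "nat \<Rightarrow> int mat" where
  "symplectic_form g = four_block_mat (0\<^sub>m g g) (1\<^sub>m g) (- 1\<^sub>m g) (0\<^sub>m g g)"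

text \<open>The parameter \<open>g\<close> is the genus: \<open>Sp_int g\<close> is \<open>Sp(2g, \<int>)\<close>.\<close>

definition Sp_int :: "nat \<Rightarrow> int mat monoid" where
  "Sp_int g = \<lparr>
     carrier = {A \<in> carrier_mat (2 * g) (2 * g).
       transpose_mat A * symplectic_form g * A = symplectic_form g},
     monoid.mult = (*),
     one = 1\<^sub>m (2 * g)\<rparr>"

end

theory Submission
  imports Defs "Jordan_Normal_Form.Determinant"
begin

text \<open>The trace of the commutator \<open>[x, y]\<close> is an invariant of the Nielsen class of a pair in
  \<open>Sp(2g, \<int>)\<close>: a Nielsen move changes \<open>[x, y]\<close> at most by conjugation and inversion, and a
  symplectic matrix has the same trace as its inverse.

  Let \<open>x\<close> be the cyclic shift \<open>e\<^sub>i \<mapsto> e\<^bsub>i+1\<^esub>\<close>, \<open>f\<^sub>i \<mapsto> f\<^bsub>i+1\<^esub>\<close> of the \<open>g\<close> handles, and let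
  \<open>y\<close> be the product of the elementary matrix \<open>e\<^sub>1 \<mapsto> e\<^sub>1 + e\<^sub>0\<close>, \<open>f\<^sub>0 \<mapsto> f\<^sub>0 - f\<^sub>1\<close> with
  \<open>e\<^sub>4 \<mapsto> n e\<^sub>4 + f\<^sub>4\<close>, \<open>f\<^sub>4 \<mapsto> - e\<^sub>4\<close>. Since the two factors of \<open>y\<close> and of its conjugate by \<open>x\<close>
  meet only in the handle 1, the commutator of \<open>y\<close> with this conjugate is again elementary. From
  it one obtains all elementary matrices, hence both factors of \<open>y\<close>, and if \<open>n\<close> is odd all of
  \<open>Sp(2g, \<int>)\<close>. On the other hand, the trace of \<open>[x, y]\<close> is \<open>2g + 2n - 4\<close>.\<close>

section \<open>The symplectic group\<close>

text \<open>Instances of library rules whose inner dimension the simplifier cannot guess.\<close>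

lemma square_closed [simp]:
  fixes A B :: "int mat"
  assumes "A \<in> carrier_mat (2 * g) (2 * g)"
  shows "v \<in> carrier_vec (2 * g) \<Longrightarrow> A *\<^sub>v v \<in> carrier_vec (2 * g)"
    and "B \<in> carrier_mat (2 * g) (2 * g) \<Longrightarrow> A * B \<in> carrier_mat (2 * g) (2 * g)"
  using assms by auto

lemmas square_vec_assoc = assoc_mult_mat_vec[of _ "2 * g" "2 * g" _ "2 * g" for g]
lemmas square_assoc = assoc_mult_mat[of _ "2 * g" "2 * g" _ "2 * g" _ "2 * g" for g]

section \<open>The symplectic form as an alternating pairing of integer vectors\<close>

definition omega :: "nat \<Rightarrow> int vec \<Rightarrow> int vec \<Rightarrow> int" where
  "omega g v w = v \<bullet> (symplectic_form g *\<^sub>v w)"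

lemma symplectic_form_carrier [simp]: "symplectic_form g \<in> carrier_mat (2 * g) (2 * g)"
  unfolding symplectic_form_def by (auto simp: mult_2)

lemma symplectic_form_dim [simp]:
  "dim_row (symplectic_form g) = 2 * g" "dim_col (symplectic_form g) = 2 * g"
  using symplectic_form_carrier[of g] by (auto simp del: symplectic_form_carrier)

lemma symplectic_form_index:
  assumes "i < 2 * g" "j < 2 * g"
  shows "symplectic_form g $$ (i, j) =
    (if i < g then (if j = g + i then 1 else 0) else (if j = i - g then - 1 else 0))"
  using assms unfolding symplectic_form_def by auto

lemma symplectic_form_mult_vec_index:
  assumes "w \<in> carrier_vec (2 * g)" "i < 2 * g"
  shows "(symplectic_form g *\<^sub>v w) $ i = (if i < g then w $ (g + i) else - w $ (i - g))"
proof -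
  have "(symplectic_form g *\<^sub>v w) $ i = (\<Sum>j\<in>{0..<2 * g}. symplectic_form g $$ (i, j) * w $ j)"
    using assms by (simp add: scalar_prod_def)
  also have "\<dots> = (\<Sum>j\<in>{0..<2 * g}. if j = (if i < g then g + i else i - g)
      then (if i < g then w $ j else - w $ j) else 0)"
    using assms by (intro sum.cong) (auto simp: symplectic_form_index)
  also have "\<dots> = (if i < g then w $ (g + i) else - w $ (i - g))"
    using assms by (subst sum.delta) auto
  finally show ?thesis .
qed

lemma omega_sum:
  assumes "v \<in> carrier_vec (2 * g)" "w \<in> carrier_vec (2 * g)"
  shows "omega g v w = (\<Sum>i<g. v $ i * w $ (g + i) - v $ (g + i) * w $ i)"
proof -
  have split: "{0..<2 * g} = {0..<g} \<union> {g..<2 * g}" by auto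
  have shift: "(\<Sum>i\<in>{g..<2 * g}. f i) = (\<Sum>i\<in>{0..<g}. f (g + i))" for f :: "nat \<Rightarrow> int"
    using sum.shift_bounds_nat_ivl[of f 0 g g] by (simp add: mult_2 add.commute)
  have "omega g v w = (\<Sum>i\<in>{0..<2 * g}. v $ i * (if i < g then w $ (g + i) else - w $ (i - g)))"
    using assms
    by (auto simp: omega_def scalar_prod_def symplectic_form_mult_vec_index simp del: index_mult_mat_vec intro!: sum.cong)
  also have "\<dots> = (\<Sum>i\<in>{0..<g}. v $ i * w $ (g + i)) + (\<Sum>i\<in>{0..<g}. - (v $ (g + i) * w $ i))"
    unfolding split by (subst sum.union_disjoint) (auto simp: shift)
  finally show ?thesis
    by (simp add: sum.distrib[symmetric] lessThan_atLeast0)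
qed

lemma omega_antisym:
  assumes "v \<in> carrier_vec (2 * g)" "w \<in> carrier_vec (2 * g)"
  shows "omega g w v = - omega g v w"
  using assms by (simp add: omega_sum sum_negf[symmetric] mult.commute)

lemma omega_self [simp]: "v \<in> carrier_vec (2 * g) \<Longrightarrow> omega g v v = 0"
  using omega_antisym[of v g v] by simp

lemma omega_add_left [simp]:
  assumes "u \<in> carrier_vec (2 * g)" "v \<in> carrier_vec (2 * g)" "w \<in> carrier_vec (2 * g)"
  shows "omega g (u + v) w = omega g u w + omega g v w"
  using assms unfolding omega_def by (intro add_scalar_prod_distrib) auto

lemma omega_smult_left [simp]:
  assumes "v \<in> carrier_vec (2 * g)" "w \<in> carrier_vec (2 * g)"
  shows "omega g (k \<cdot>\<^sub>v v) w = k * omega g v w"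
  using assms unfolding omega_def by simp

lemma omega_add_right [simp]:
  assumes "u \<in> carrier_vec (2 * g)" "v \<in> carrier_vec (2 * g)" "w \<in> carrier_vec (2 * g)"
  shows "omega g w (u + v) = omega g w u + omega g w v"
  using assms omega_antisym[of _ g w] omega_add_left[of u g v w] by fastforce

lemma omega_smult_right [simp]:
  assumes "v \<in> carrier_vec (2 * g)" "w \<in> carrier_vec (2 * g)"
  shows "omega g w (k \<cdot>\<^sub>v v) = k * omega g w v"
  using assms omega_antisym[of _ g w] omega_smult_left[of v g w k] by fastforce

lemma omega_uminus_left [simp]:
  assumes "v \<in> carrier_vec (2 * g)" "w \<in> carrier_vec (2 * g)"
  shows "omega g (- v) w = - omega g v w"
  using assms unfolding omega_def by simp

lemma omega_uminus_right [simp]: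
  assumes "v \<in> carrier_vec (2 * g)" "w \<in> carrier_vec (2 * g)"
  shows "omega g w (- v) = - omega g w v"
  using assms omega_antisym[of _ g w] omega_uminus_left[of v g w] by fastforce

lemma omega_unit_left:
  assumes "w \<in> carrier_vec (2 * g)" "i < 2 * g"
  shows "omega g (unit_vec (2 * g) i) w = (if i < g then w $ (g + i) else - w $ (i - g))"
proof -
  have "symplectic_form g *\<^sub>v w \<in> carrier_vec (2 * g)"
    using assms by simp
  then show ?thesis
    using assms scalar_prod_left_unit[of "symplectic_form g *\<^sub>v w" "2 * g" i]
    by (simp add: omega_def symplectic_form_mult_vec_index del: index_mult_mat_vec)
qed

lemma omega_unit_right:
  assumes "w \<in> carrier_vec (2 * g)" "i < 2 * g"
  shows "omega g w (unit_vec (2 * g) i) = (if i < g then - w $ (g + i) else w $ (i - g))"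
  using omega_antisym[of "unit_vec (2 * g) i" g w] assms by (simp add: omega_unit_left)

lemma mat_eq_on_vecI:
  fixes A B :: "int mat"
  assumes "A \<in> carrier_mat n n" "B \<in> carrier_mat n n"
    and "\<And>v. v \<in> carrier_vec n \<Longrightarrow> A *\<^sub>v v = B *\<^sub>v v"
  shows "A = B"
proof (rule eq_matI)
  fix i j assume "i < dim_row B" "j < dim_col B"
  then have ij: "i < n" "j < n" using assms by auto
  have "A $$ (i, j) = (A *\<^sub>v unit_vec n j) $ i"
    using ij assms(1) by simp
  also have "\<dots> = (B *\<^sub>v unit_vec n j) $ i"
    using assms(3)[of "unit_vec n j"] by simp
  also have "\<dots> = B $$ (i, j)"
    using ij assms(2) by simp
  finally show "A $$ (i, j) = B $$ (i, j)" .
qed (use assms in auto)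

section \<open>Symplectic matrices as isometries of the pairing\<close>

lemma omega_mult_mat_vec:
  assumes A: "A \<in> carrier_mat (2 * g) (2 * g)"
    and v: "v \<in> carrier_vec (2 * g)" and w: "w \<in> carrier_vec (2 * g)"
  shows "omega g (A *\<^sub>v v) (A *\<^sub>v w) = v \<bullet> ((transpose_mat A * symplectic_form g * A) *\<^sub>v w)"
proof -
  have "(transpose_mat A * symplectic_form g * A) *\<^sub>v w
      = transpose_mat A *\<^sub>v (symplectic_form g *\<^sub>v (A *\<^sub>v w))"
    using A w by (simp add: square_vec_assoc[of _ g])
  moreover have "v \<bullet> (transpose_mat A *\<^sub>v u) = (A *\<^sub>v v) \<bullet> u" if "u \<in> carrier_vec (2 * g)" for u
    using transpose_vec_mult_scalar[OF A v that] v that A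
    by (metis carrier_vec_dim_vec mult_mat_vec_carrier comm_scalar_prod transpose_carrier_mat)
  ultimately show ?thesis
    using A w by (simp add: omega_def)
qed

text \<open>The entries of \<open>transpose_mat A * symplectic_form g * A\<close> are the pairings
  of the columns of \<open>A\<close>.\<close>

lemma Sp_int_unitI:
  assumes A: "A \<in> carrier_mat (2 * g) (2 * g)"
    and unit: "\<And>i j. i < 2 * g \<Longrightarrow> j < 2 * g \<Longrightarrow>
      omega g (A *\<^sub>v unit_vec (2 * g) i) (A *\<^sub>v unit_vec (2 * g) j)
        = omega g (unit_vec (2 * g) i) (unit_vec (2 * g) j)"
  shows "A \<in> carrier (Sp_int g)"
proof -
  let ?M = "transpose_mat A * symplectic_form g * A"
  have M: "?M \<in> carrier_mat (2 * g) (2 * g)" using A by simp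
  have entry: "B $$ (i, j) = unit_vec (2 * g) i \<bullet> (B *\<^sub>v unit_vec (2 * g) j)"
    if "B \<in> carrier_mat (2 * g) (2 * g)" "i < 2 * g" "j < 2 * g" for B :: "int mat" and i j
    using that by (subst scalar_prod_left_unit[of _ "2 * g"]) auto
  have "?M = symplectic_form g"
  proof (rule eq_matI)
    fix i j assume "i < dim_row (symplectic_form g)" "j < dim_col (symplectic_form g)"
    then have ij: "i < 2 * g" "j < 2 * g" by auto
    have "?M $$ (i, j) = omega g (unit_vec (2 * g) i) (unit_vec (2 * g) j)"
      using unit[OF ij] omega_mult_mat_vec[OF A, of "unit_vec (2 * g) i" "unit_vec (2 * g) j"]
        entry[OF M ij] by simp
    also have "\<dots> = symplectic_form g $$ (i, j)"
      using entry[OF symplectic_form_carrier ij] by (simp add: omega_def)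
    finally show "?M $$ (i, j) = symplectic_form g $$ (i, j)" .
  qed (use A in auto)
  then show ?thesis using A by (simp add: Sp_int_def)
qed

lemma Sp_int_carrier_iff:
  "A \<in> carrier (Sp_int g) \<longleftrightarrow> A \<in> carrier_mat (2 * g) (2 * g) \<and>
    (\<forall>v\<in>carrier_vec (2 * g). \<forall>w\<in>carrier_vec (2 * g). omega g (A *\<^sub>v v) (A *\<^sub>v w) = omega g v w)"
    (is "?L \<longleftrightarrow> ?R")
proof
  show ?R if ?L
    using that omega_mult_mat_vec[of A g] by (simp add: Sp_int_def omega_def)
  show ?L if ?R
    using that by (intro Sp_int_unitI) auto
qed

text \<open>Over a field one-sided inverses of square matrices are two-sided. The entrywise
  embedding into the rationals is multiplicative and injective, so this descends to the
  integers.\<close>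

lemma int_mat_mult_left_right_inverse:
  fixes A B :: "int mat"
  assumes A: "A \<in> carrier_mat n n" and B: "B \<in> carrier_mat n n" and AB: "A * B = 1\<^sub>m n"
  shows "B * A = 1\<^sub>m n"
proof -
  let ?h = "map_mat (of_int :: int \<Rightarrow> rat)"
  have "?h A * ?h B = 1\<^sub>m n"
    using AB by (simp add: of_int_hom.mat_hom_mult[OF A B, symmetric] of_int_hom.mat_hom_one)
  then have "?h B * ?h A = 1\<^sub>m n"
    by (rule mat_mult_left_right_inverse[rotated 2]) (use A B in auto)
  then have "?h (B * A) = ?h (1\<^sub>m n)"
    by (simp add: of_int_hom.mat_hom_mult[OF B A] of_int_hom.mat_hom_one)
  then show ?thesis by (rule of_int_hom.mat_hom_inj)
qed

lemma symplectic_form_square: "symplectic_form g * symplectic_form g = - 1\<^sub>m (2 * g)"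
proof (rule mat_eq_on_vecI)
  fix v :: "int vec" assume v: "v \<in> carrier_vec (2 * g)"
  have "symplectic_form g *\<^sub>v (symplectic_form g *\<^sub>v v) = - v"
  proof (rule eq_vecI)
    fix i assume "i < dim_vec (- v)"
    then have "i < 2 * g" using v by simp
    then show "(symplectic_form g *\<^sub>v (symplectic_form g *\<^sub>v v)) $ i = (- v) $ i"
      using v
      by (auto simp: symplectic_form_mult_vec_index simp del: index_mult_mat_vec)
  qed (use v in auto)
  moreover have "(- 1\<^sub>m (2 * g)) *\<^sub>v v = - v"
    using v uminus_mult_mat_vec[of v "1\<^sub>m (2 * g)"] by simp
  ultimately show "(symplectic_form g * symplectic_form g) *\<^sub>v v = (- 1\<^sub>m (2 * g)) *\<^sub>v v"
    using v by (simp add: square_vec_assoc[of _ g])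
qed auto

section \<open>The group structure of \<open>Sp_int g\<close>\<close>

lemma Sp_int_simps [simp]:
  "A \<otimes>\<^bsub>Sp_int g\<^esub> B = A * B" "\<one>\<^bsub>Sp_int g\<^esub> = 1\<^sub>m (2 * g)"
  by (simp_all add: Sp_int_def)

lemma Sp_int_carrier_mat: "A \<in> carrier (Sp_int g) \<Longrightarrow> A \<in> carrier_mat (2 * g) (2 * g)"
  by (simp add: Sp_int_def)

lemma Sp_int_omega:
  assumes "A \<in> carrier (Sp_int g)" "v \<in> carrier_vec (2 * g)" "w \<in> carrier_vec (2 * g)"
  shows "omega g (A *\<^sub>v v) (A *\<^sub>v w) = omega g v w"
  using assms Sp_int_carrier_iff by blast

text \<open>With \<open>J = symplectic_form g\<close>, the defining equation turns the product into
  \<open>- (J * J)\<close>, and \<open>J\<close> squares to minus the identity.\<close>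

lemma Sp_int_left_inverse:
  assumes "A \<in> carrier (Sp_int g)"
  shows "- (symplectic_form g * transpose_mat A * symplectic_form g) * A = 1\<^sub>m (2 * g)"
proof -
  let ?J = "symplectic_form g"
  have A: "A \<in> carrier_mat (2 * g) (2 * g)" and eq: "transpose_mat A * ?J * A = ?J"
    using assms by (auto simp: Sp_int_def)
  have "- (?J * transpose_mat A * ?J) * A = - ((?J * transpose_mat A * ?J) * A)"
    using A by (intro uminus_mult_left_mat) auto
  also have "\<dots> = - (?J * (transpose_mat A * ?J * A))"
    using A by (simp add: square_assoc[of _ g])
  finally have "- (?J * transpose_mat A * ?J) * A = - (?J * (transpose_mat A * ?J * A))" .
  then show ?thesis by (simp add: eq symplectic_form_square)
qed

lemma Sp_int_group: "group (Sp_int g)"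
proof (rule groupI)
  fix A B assume A: "A \<in> carrier (Sp_int g)" and B: "B \<in> carrier (Sp_int g)"
  then show "A \<otimes>\<^bsub>Sp_int g\<^esub> B \<in> carrier (Sp_int g)"
    unfolding Sp_int_carrier_iff Sp_int_simps
    by (auto simp: square_vec_assoc[of _ g])
next
  fix A assume A: "A \<in> carrier (Sp_int g)"
  let ?B = "- (symplectic_form g * transpose_mat A * symplectic_form g)"
  note Am = Sp_int_carrier_mat[OF A]
  have Bm: "?B \<in> carrier_mat (2 * g) (2 * g)" using Am by simp
  have BA: "?B * A = 1\<^sub>m (2 * g)" by (rule Sp_int_left_inverse[OF A])
  then have AB: "A * ?B = 1\<^sub>m (2 * g)" by (rule int_mat_mult_left_right_inverse[OF Bm Am])
  \<comment> \<open>\<open>A\<close> preserves the pairing and undoes \<open>?B\<close>, so the left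
    side can be evaluated after applying \<open>A\<close> to both vectors.\<close>
  have "omega g (?B *\<^sub>v v) (?B *\<^sub>v w) = omega g v w"
    if "v \<in> carrier_vec (2 * g)" "w \<in> carrier_vec (2 * g)" for v w
  proof -
    have "A *\<^sub>v (?B *\<^sub>v u) = u" if "u \<in> carrier_vec (2 * g)" for u
      using assoc_mult_mat_vec[OF Am Bm that] AB that by simp
    then show ?thesis
      using Sp_int_omega[OF A mult_mat_vec_carrier[OF Bm that(1)] mult_mat_vec_carrier[OF Bm that(2)]]
        that by (simp del: uminus_mult_left_mat uminus_mult_mat_vec)
  qed
  then have "?B \<in> carrier (Sp_int g)" using Bm by (simp add: Sp_int_carrier_iff)
  then show "\<exists>B\<in>carrier (Sp_int g). B \<otimes>\<^bsub>Sp_int g\<^esub> A = \<one>\<^bsub>Sp_int g\<^esub>" using BA by auto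
next
  fix A B C assume "A \<in> carrier (Sp_int g)" "B \<in> carrier (Sp_int g)" "C \<in> carrier (Sp_int g)"
  then show "A \<otimes>\<^bsub>Sp_int g\<^esub> B \<otimes>\<^bsub>Sp_int g\<^esub> C = A \<otimes>\<^bsub>Sp_int g\<^esub> (B \<otimes>\<^bsub>Sp_int g\<^esub> C)"
    by (simp add: Sp_int_def square_assoc[of _ g])
next
  fix A assume "A \<in> carrier (Sp_int g)"
  then show "\<one>\<^bsub>Sp_int g\<^esub> \<otimes>\<^bsub>Sp_int g\<^esub> A = A"
    using left_mult_one_mat[OF Sp_int_carrier_mat] by simp
qed (simp add: Sp_int_carrier_iff)

section \<open>Traces of symplectic matrices\<close>

definition trace :: "int mat \<Rightarrow> int" where
  "trace A = (\<Sum>i<dim_row A. A $$ (i, i))"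

lemma trace_mult_comm:
  assumes "A \<in> carrier_mat n n" "B \<in> carrier_mat n n"
  shows "trace (A * B) = trace (B * A)"
proof -
  have "trace (A * B) = (\<Sum>i<n. \<Sum>j<n. A $$ (i, j) * B $$ (j, i))"
    using assms by (auto simp: trace_def scalar_prod_def lessThan_atLeast0 intro!: sum.cong)
  also have "\<dots> = (\<Sum>j<n. \<Sum>i<n. B $$ (j, i) * A $$ (i, j))"
    by (subst sum.swap) (simp add: mult.commute)
  also have "\<dots> = trace (B * A)"
    using assms by (auto simp: trace_def scalar_prod_def lessThan_atLeast0 intro!: sum.cong)
  finally show ?thesis .
qed

lemma trace_uminus: "A \<in> carrier_mat n n \<Longrightarrow> trace (- A) = - trace A"
  by (simp add: trace_def sum_negf)

lemma trace_transpose: "A \<in> carrier_mat n n \<Longrightarrow> trace (transpose_mat A) = trace A"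
  by (auto simp: trace_def intro!: sum.cong)

text \<open>With \<open>J = symplectic_form g\<close> the inverse is
  \<open>- (J * transpose_mat A * J)\<close>. Cyclicity of the trace brings the two factors
  \<open>J\<close> together, and their product is minus the identity.\<close>

lemma trace_Sp_int_inv:
  assumes A: "A \<in> carrier (Sp_int g)"
  shows "trace (inv\<^bsub>Sp_int g\<^esub> A) = trace A"
proof -
  interpret G: group "Sp_int g" by (rule Sp_int_group)
  let ?J = "symplectic_form g"
  let ?B = "- (?J * transpose_mat A * ?J)"
  note Am = Sp_int_carrier_mat[OF A]
  have inv: "inv\<^bsub>Sp_int g\<^esub> A \<in> carrier_mat (2 * g) (2 * g)" "inv\<^bsub>Sp_int g\<^esub> A * A = 1\<^sub>m (2 * g)"
    "A * inv\<^bsub>Sp_int g\<^esub> A = 1\<^sub>m (2 * g)"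
    using A G.l_inv[OF A] G.r_inv[OF A] Sp_int_carrier_mat by auto
  have "inv\<^bsub>Sp_int g\<^esub> A = (?B * A) * inv\<^bsub>Sp_int g\<^esub> A"
    using inv(1) Sp_int_left_inverse[OF A] by simp
  also have "\<dots> = ?B"
    using inv Am square_assoc[of ?B g A "inv\<^bsub>Sp_int g\<^esub> A"] by simp
  finally have "trace (inv\<^bsub>Sp_int g\<^esub> A) = - trace (?J * transpose_mat A * ?J)"
    using Am by (simp add: trace_uminus[of _ "2 * g"])
  also have "trace (?J * transpose_mat A * ?J) = trace (?J * (?J * transpose_mat A))"
    using Am by (intro trace_mult_comm[of _ "2 * g"]) auto
  also have "?J * (?J * transpose_mat A) = - transpose_mat A"
    using Am by (simp add: square_assoc[of _ g, symmetric]
        symplectic_form_square)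
  finally show ?thesis
    using Am by (simp add: trace_uminus[of _ "2 * g"] trace_transpose[of _ "2 * g"])
qed

section \<open>Transvections and Eichler transformations\<close>

lemma square_smult_vec:
  fixes A :: "int mat"
  assumes "A \<in> carrier_mat (2 * g) (2 * g)" "v \<in> carrier_vec (2 * g)"
  shows "A *\<^sub>v (k \<cdot>\<^sub>v v) = k \<cdot>\<^sub>v (A *\<^sub>v v)"
  using assms by (intro eq_vecI) auto

lemma omega_zero_right [simp]: "v \<in> carrier_vec (2 * g) \<Longrightarrow> omega g v (0\<^sub>v (2 * g)) = 0"
  using omega_add_right[of "0\<^sub>v (2 * g)" g "0\<^sub>v (2 * g)" v] by simp

lemma omega_expand:
  assumes "v \<in> carrier_vec (2 * g)" "w \<in> carrier_vec (2 * g)"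
  shows "omega g v w = (\<Sum>j\<in>{0..<2 * g}. v $ j * omega g (unit_vec (2 * g) j) w)"
  using assms
  by (auto simp: omega_def scalar_prod_def[of v] scalar_prod_left_unit[of _ "2 * g"]
      simp del: index_mult_mat_vec intro!: sum.cong)

text \<open>The parameters make room at once for transvections, for their rank two analogues, and for
  \<open>SL(2, \<int>)\<close> acting on the plane spanned by \<open>p\<close> and \<open>q\<close>.\<close>

definition rank2 :: "nat \<Rightarrow> int vec \<Rightarrow> int vec \<Rightarrow> int \<Rightarrow> int \<Rightarrow> int \<Rightarrow> int \<Rightarrow> int mat" where
  "rank2 g p q a b c d = mat (2 * g) (2 * g) (\<lambda>(i, j). (if i = j then 1 else 0)
     + (a * omega g (unit_vec (2 * g) j) p + b * omega g (unit_vec (2 * g) j) q) * p $ i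
     + (c * omega g (unit_vec (2 * g) j) p + d * omega g (unit_vec (2 * g) j) q) * q $ i)"

lemma rank2_carrier_mat [simp]: "rank2 g p q a b c d \<in> carrier_mat (2 * g) (2 * g)"
  by (simp add: rank2_def)

lemma rank2_dim [simp]:
  "dim_row (rank2 g p q a b c d) = 2 * g" "dim_col (rank2 g p q a b c d) = 2 * g"
  by (simp_all add: rank2_def)

lemma rank2_mult_vec:
  assumes p: "p \<in> carrier_vec (2 * g)" and q: "q \<in> carrier_vec (2 * g)" and v: "v \<in> carrier_vec (2 * g)"
  shows "rank2 g p q a b c d *\<^sub>v v = v + ((a * omega g v p + b * omega g v q) \<cdot>\<^sub>v p
    + (c * omega g v p + d * omega g v q) \<cdot>\<^sub>v q)"
proof (rule eq_vecI)
  let ?P = "\<lambda>j. omega g (unit_vec (2 * g) j) p" and ?Q = "\<lambda>j. omega g (unit_vec (2 * g) j) q"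
  fix i assume "i < dim_vec (v + ((a * omega g v p + b * omega g v q) \<cdot>\<^sub>v p
    + (c * omega g v p + d * omega g v q) \<cdot>\<^sub>v q))"
  then have i: "i < 2 * g" using q by simp
  have "(rank2 g p q a b c d *\<^sub>v v) $ i = (\<Sum>j\<in>{0..<2 * g}. ((if i = j then 1 else 0)
      + (a * ?P j + b * ?Q j) * p $ i + (c * ?P j + d * ?Q j) * q $ i) * v $ j)"
    using i v by (simp add: scalar_prod_def rank2_def)
  also have "\<dots> = (\<Sum>j\<in>{0..<2 * g}. (if i = j then v $ j else 0)
      + ((a * p $ i + c * q $ i) * (v $ j * ?P j) + (b * p $ i + d * q $ i) * (v $ j * ?Q j)))"
    by (intro sum.cong) (auto simp: algebra_simps)
  also have "\<dots> = v $ i + ((a * p $ i + c * q $ i) * omega g v p + (b * p $ i + d * q $ i) * omega g v q)"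
    using i by (simp add: sum.distrib sum_distrib_left[symmetric] omega_expand[OF v p] omega_expand[OF v q])
  finally show "(rank2 g p q a b c d *\<^sub>v v) $ i = (v + ((a * omega g v p + b * omega g v q) \<cdot>\<^sub>v p
      + (c * omega g v p + d * omega g v q) \<cdot>\<^sub>v q)) $ i"
    using i p q v by (simp add: algebra_simps)
qed (use p q v in auto)

text \<open>The pairing of \<open>v\<close> and \<open>w\<close> changes by the left side of
  \<open>eq\<close> times \<open>omega g v p * omega g w q - omega g v q * omega g w p\<close>. If
  \<open>omega g p q = 1\<close>, then \<open>eq\<close> says that the block on the plane of
  \<open>p\<close> and \<open>q\<close> has determinant 1.\<close>

lemma rank2_Sp:
  assumes p: "p \<in> carrier_vec (2 * g)" and q: "q \<in> carrier_vec (2 * g)"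
    and eq: "b - c + omega g p q * (a * d - b * c) = 0"
  shows "rank2 g p q a b c d \<in> carrier (Sp_int g)"
  unfolding Sp_int_carrier_iff
proof (intro conjI ballI)
  fix v w :: "int vec" assume v: "v \<in> carrier_vec (2 * g)" and w: "w \<in> carrier_vec (2 * g)"
  let ?s = "omega g p q" and ?P = "omega g v p" and ?Q = "omega g v q"
    and ?P' = "omega g w p" and ?Q' = "omega g w q"
  have anti: "omega g q p = - ?s" "omega g p w = - ?P'" "omega g q w = - ?Q'"
    by (rule omega_antisym; use p q v w in simp)+
  have "omega g (rank2 g p q a b c d *\<^sub>v v) (rank2 g p q a b c d *\<^sub>v w)
      = omega g v w + (b - c + ?s * (a * d - b * c)) * (?P * ?Q' - ?Q * ?P')"
    using p q v w by (simp add: rank2_mult_vec anti algebra_simps)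
  then show "omega g (rank2 g p q a b c d *\<^sub>v v) (rank2 g p q a b c d *\<^sub>v w) = omega g v w"
    by (simp add: eq)
qed simp

lemma rank2_conj:
  assumes A: "A \<in> carrier (Sp_int g)" and p: "p \<in> carrier_vec (2 * g)" and q: "q \<in> carrier_vec (2 * g)"
  shows "A * rank2 g p q a b c d = rank2 g (A *\<^sub>v p) (A *\<^sub>v q) a b c d * A"
proof (rule mat_eq_on_vecI)
  note Am = Sp_int_carrier_mat[OF A]
  fix v :: "int vec" assume v: "v \<in> carrier_vec (2 * g)"
  show "(A * rank2 g p q a b c d) *\<^sub>v v = (rank2 g (A *\<^sub>v p) (A *\<^sub>v q) a b c d * A) *\<^sub>v v"
    using p q v Am
    by (simp add: square_vec_assoc[of _ g] rank2_mult_vec Sp_int_omega[OF A]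
        mult_add_distrib_mat_vec[of _ "2 * g" "2 * g"] square_smult_vec)
qed (use Sp_int_carrier_mat[OF A] in auto)

definition transvection :: "nat \<Rightarrow> int \<Rightarrow> int vec \<Rightarrow> int mat" where
  "transvection g k p = rank2 g p p k 0 0 0"

text \<open>For \<open>p = e_vec g i\<close> and \<open>q = f_vec g j\<close> in different handles
  this is the elementary matrix adding \<open>e_vec g i\<close> to \<open>e_vec g j\<close> and
  subtracting \<open>f_vec g j\<close> from \<open>f_vec g i\<close>.\<close>

definition eichler :: "nat \<Rightarrow> int vec \<Rightarrow> int vec \<Rightarrow> int mat" where
  "eichler g p q = rank2 g p q 0 1 1 0"

lemma transvection_carrier_mat [simp]:
  "transvection g k p \<in> carrier_mat (2 * g) (2 * g)"
  by (simp add: transvection_def)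

lemma eichler_carrier_mat [simp]: "eichler g p q \<in> carrier_mat (2 * g) (2 * g)"
  by (simp add: eichler_def)

lemma transvection_mult_vec:
  assumes "p \<in> carrier_vec (2 * g)" "v \<in> carrier_vec (2 * g)"
  shows "transvection g k p *\<^sub>v v = v + (k * omega g v p) \<cdot>\<^sub>v p"
  using assms by (auto simp: transvection_def rank2_mult_vec)

lemma eichler_mult_vec:
  assumes "p \<in> carrier_vec (2 * g)" "q \<in> carrier_vec (2 * g)" "v \<in> carrier_vec (2 * g)"
  shows "eichler g p q *\<^sub>v v = v + (omega g v q \<cdot>\<^sub>v p + omega g v p \<cdot>\<^sub>v q)"
  using assms by (auto simp: eichler_def rank2_mult_vec)

lemma transvection_Sp: "p \<in> carrier_vec (2 * g) \<Longrightarrow> transvection g k p \<in> carrier (Sp_int g)"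
  unfolding transvection_def by (rule rank2_Sp) auto

lemma eichler_Sp:
  assumes "p \<in> carrier_vec (2 * g)" "q \<in> carrier_vec (2 * g)" "omega g p q = 0"
  shows "eichler g p q \<in> carrier (Sp_int g)"
  unfolding eichler_def using assms by (intro rank2_Sp) auto

lemma eichler_commute:
  assumes "p \<in> carrier_vec (2 * g)" "q \<in> carrier_vec (2 * g)"
  shows "eichler g p q = eichler g q p"
  using assms by (intro mat_eq_on_vecI[of _ "2 * g"]) (auto simp: eichler_mult_vec comm_add_vec[of _ "2 * g"])

lemma transvection_add:
  assumes "p \<in> carrier_vec (2 * g)"
  shows "transvection g k p * transvection g l p = transvection g (k + l) p"
proof (rule mat_eq_on_vecI[of _ "2 * g"])
  fix v :: "int vec" assume "v \<in> carrier_vec (2 * g)"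
  then show "(transvection g k p * transvection g l p) *\<^sub>v v = transvection g (k + l) p *\<^sub>v v"
    using assms by (intro eq_vecI)
      (auto simp: square_vec_assoc[of _ g] transvection_mult_vec ring_distribs simp del: index_mult_mat_vec)
qed auto

text \<open>The right factor changes the pairing with \<open>q\<close> by
  \<open>omega g r q * omega g v p\<close>, and this correction is a transvection along
  \<open>p\<close>. It is a Heisenberg relation with the transvections along \<open>p\<close> as
  central terms; these central terms later yield the elementary transvections.\<close>

lemma eichler_add:
  assumes p: "p \<in> carrier_vec (2 * g)" and q: "q \<in> carrier_vec (2 * g)" and r: "r \<in> carrier_vec (2 * g)"
    and orth: "omega g p q = 0" "omega g p r = 0"
  shows "eichler g p q * eichler g p r = eichler g p (q + r) * transvection g (omega g r q) p"
proof (rule mat_eq_on_vecI[of _ "2 * g"])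
  have "omega g q p = 0" "omega g r p = 0"
    using orth omega_antisym[OF p q] omega_antisym[OF p r] by auto
  moreover fix v :: "int vec" assume "v \<in> carrier_vec (2 * g)"
  ultimately show "(eichler g p q * eichler g p r) *\<^sub>v v
      = (eichler g p (q + r) * transvection g (omega g r q) p) *\<^sub>v v"
    using p q r orth
    by (intro eq_vecI) (auto simp: square_vec_assoc[of _ g] transvection_mult_vec eichler_mult_vec
        ring_distribs simp del: index_mult_mat_vec)
qed auto

lemma transvection_zero: "p \<in> carrier_vec (2 * g) \<Longrightarrow> transvection g 0 p = 1\<^sub>m (2 * g)"
  by (intro mat_eq_on_vecI[of _ "2 * g"]) (auto simp: transvection_mult_vec)

lemma eichler_add_orthogonal:
  assumes p: "p \<in> carrier_vec (2 * g)" and q: "q \<in> carrier_vec (2 * g)" and r: "r \<in> carrier_vec (2 * g)"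
    and orth: "omega g p q = 0" "omega g p r = 0" "omega g r q = 0"
  shows "eichler g p q * eichler g p r = eichler g p (q + r)"
  using eichler_add[OF p q r orth(1,2)] transvection_zero[OF p] orth(3)
    right_mult_one_mat[OF eichler_carrier_mat] by simp

lemma eichler_zero: "p \<in> carrier_vec (2 * g) \<Longrightarrow> eichler g p (0\<^sub>v (2 * g)) = 1\<^sub>m (2 * g)"
  by (intro mat_eq_on_vecI[of _ "2 * g"])
    (auto simp: eichler_mult_vec)

lemma transvection_uminus: "p \<in> carrier_vec (2 * g) \<Longrightarrow> transvection g k (- p) = transvection g k p"
  by (intro mat_eq_on_vecI[of _ "2 * g"]) (auto simp: transvection_mult_vec)

lemma eichler_uminus_uminus:
  assumes "p \<in> carrier_vec (2 * g)" "q \<in> carrier_vec (2 * g)"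
  shows "eichler g (- p) q = eichler g p (- q)"
  using assms by (intro mat_eq_on_vecI[of _ "2 * g"]) (auto simp: eichler_mult_vec)

section \<open>Membership rules for a subgroup of the symplectic group\<close>

locale Sp_subgroup =
  fixes g :: nat and H :: "int mat set"
  assumes H: "subgroup H (Sp_int g)"
begin

sublocale group "Sp_int g"
  by (rule Sp_int_group)

lemma in_Sp: "A \<in> H \<Longrightarrow> A \<in> carrier (Sp_int g)"
  using subgroup.mem_carrier[OF H] by simp

lemma one_in: "1\<^sub>m (2 * g) \<in> H"
  using subgroup.one_closed[OF H] by simp

lemma mult_in: "A \<in> H \<Longrightarrow> B \<in> H \<Longrightarrow> A * B \<in> H"
  using subgroup.m_closed[OF H] by simp

lemma cancel_left:
  assumes "A \<in> H" "A * B \<in> H" "B \<in> carrier (Sp_int g)"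
  shows "B \<in> H"
proof -
  have "inv\<^bsub>Sp_int g\<^esub> A \<otimes>\<^bsub>Sp_int g\<^esub> (A \<otimes>\<^bsub>Sp_int g\<^esub> B) = B"
    using assms in_Sp by (simp add: m_assoc[symmetric] del: Sp_int_simps)
  moreover have "inv\<^bsub>Sp_int g\<^esub> A \<otimes>\<^bsub>Sp_int g\<^esub> (A \<otimes>\<^bsub>Sp_int g\<^esub> B) \<in> H"
    using assms subgroup.m_closed[OF H] subgroup.m_inv_closed[OF H] by simp
  ultimately show ?thesis by simp
qed

lemma cancel_right:
  assumes "B \<in> H" "A * B \<in> H" "A \<in> carrier (Sp_int g)"
  shows "A \<in> H"
proof -
  have "(A \<otimes>\<^bsub>Sp_int g\<^esub> B) \<otimes>\<^bsub>Sp_int g\<^esub> inv\<^bsub>Sp_int g\<^esub> B = A"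
    using assms in_Sp by (simp add: m_assoc del: Sp_int_simps)
  moreover have "(A \<otimes>\<^bsub>Sp_int g\<^esub> B) \<otimes>\<^bsub>Sp_int g\<^esub> inv\<^bsub>Sp_int g\<^esub> B \<in> H"
    using assms subgroup.m_closed[OF H] subgroup.m_inv_closed[OF H] by simp
  ultimately show ?thesis by simp
qed

text \<open>Conjugation enters as an exchange relation, the form given by \<open>rank2_conj\<close>,
  so that no inverse matrix has to be computed.\<close>

lemma conj_in:
  assumes "A \<in> H" "B \<in> H" "A * B = C * A" "C \<in> carrier (Sp_int g)"
  shows "C \<in> H"
  using cancel_right[of A C] mult_in[OF assms(1,2)] assms by simp

lemma conj_inv_in:
  assumes "A \<in> H" "C \<in> H" "A * B = C * A" "B \<in> carrier (Sp_int g)"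
  shows "B \<in> H"
  using cancel_left[of A B] mult_in[OF assms(2,1)] assms by simp

lemma transvection_conj_inv_in:
  assumes "A \<in> H" "p \<in> carrier_vec (2 * g)" "transvection g k (A *\<^sub>v p) \<in> H"
  shows "transvection g k p \<in> H"
  using conj_inv_in[OF assms(1,3)] rank2_conj[OF in_Sp[OF assms(1)] assms(2) assms(2)]
    transvection_Sp[of p g k] assms(2)
  by (simp add: transvection_def)

lemma eichler_conj_in:
  assumes A: "A \<in> H" and p: "p \<in> carrier_vec (2 * g)" and q: "q \<in> carrier_vec (2 * g)"
    and "omega g p q = 0" "eichler g p q \<in> H"
  shows "eichler g (A *\<^sub>v p) (A *\<^sub>v q) \<in> H"
  using conj_in[OF A assms(5)] rank2_conj[OF in_Sp[OF A] p q]
    eichler_Sp[of "A *\<^sub>v p" g "A *\<^sub>v q"] Sp_int_carrier_mat[OF in_Sp[OF A]] p q assms(4)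
  by (simp add: eichler_def Sp_int_omega[OF in_Sp[OF A]])

lemma eichler_conj_inv_in:
  assumes A: "A \<in> H" and p: "p \<in> carrier_vec (2 * g)" and q: "q \<in> carrier_vec (2 * g)"
    and "omega g p q = 0" "eichler g (A *\<^sub>v p) (A *\<^sub>v q) \<in> H"
  shows "eichler g p q \<in> H"
  using conj_inv_in[OF A assms(5)] rank2_conj[OF in_Sp[OF A] p q]
    eichler_Sp[of p g q] p q assms(4)
  by (simp add: eichler_def)

lemma transvection_multiple_in:
  assumes p: "p \<in> carrier_vec (2 * g)" and k: "transvection g k p \<in> H"
  shows "transvection g (m * k) p \<in> H"
proof -
  have nat: "transvection g (int n * l) p \<in> H" if "transvection g l p \<in> H" for n l
  proof (induction n)
    case 0
    then show ?case using transvection_zero[OF p] one_in by simp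
  next
    case (Suc n)
    then show ?case
      using mult_in[OF that Suc] transvection_add[OF p] by (simp add: algebra_simps)
  qed
  have "transvection g (- k) p \<in> H"
    using cancel_left[OF k, of "transvection g (- k) p"] transvection_add[OF p, of k "- k"]
      transvection_zero[OF p] one_in transvection_Sp[OF p] by simp
  \<comment> \<open>A negative \<open>m\<close> is treated as \<open>(- m) * (- k)\<close>.\<close>
  then show ?thesis
    using nat[OF k, of "nat m"] nat[of "- k" "nat (- m)"] by (cases "m \<ge> 0") auto
qed

lemma eichler_uminus_in:
  assumes p: "p \<in> carrier_vec (2 * g)" and q: "q \<in> carrier_vec (2 * g)"
    and "omega g p q = 0" "eichler g p q \<in> H"
  shows "eichler g p (- q) \<in> H"
proof -
  have "q + - q = 0\<^sub>v (2 * g)" using q by auto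
  then show ?thesis
    using cancel_left[OF assms(4), of "eichler g p (- q)"] eichler_add_orthogonal[OF p q, of "- q"] assms
      eichler_Sp[of p g "- q"] eichler_zero[OF p] one_in by simp
qed

lemma eichler_add_cancel_in:
  assumes p: "p \<in> carrier_vec (2 * g)" and q: "q \<in> carrier_vec (2 * g)" and r: "r \<in> carrier_vec (2 * g)"
    and orth: "omega g p q = 0" "omega g p r = 0" "omega g r q = 0"
    and "eichler g p q \<in> H" "eichler g p (q + r) \<in> H"
  shows "eichler g p r \<in> H"
  using cancel_left[OF assms(7), of "eichler g p r"] eichler_add_orthogonal[OF p q r orth]
    eichler_Sp[OF p r orth(2)] assms(8) by simp

text \<open>Multiples of \<open>q\<close> are orthogonal to each other, so the central term of
  \<open>eichler_add\<close> vanishes and powers of the given element realise them.\<close>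

lemma eichler_multiple_in:
  assumes p: "p \<in> carrier_vec (2 * g)" and q: "q \<in> carrier_vec (2 * g)"
    and orth: "omega g p q = 0" and E: "eichler g p q \<in> H"
  shows "eichler g p (m \<cdot>\<^sub>v q) \<in> H"
proof -
  have nat: "eichler g p (int n \<cdot>\<^sub>v r) \<in> H"
    if r: "r \<in> carrier_vec (2 * g)" "omega g p r = 0" "eichler g p r \<in> H" for n r
  proof (induction n)
    case 0
    have "int 0 \<cdot>\<^sub>v r = 0\<^sub>v (2 * g)" using r by auto
    then show ?case using eichler_zero[OF p] one_in by simp
  next
    case (Suc n)
    have "int (Suc n) \<cdot>\<^sub>v r = r + int n \<cdot>\<^sub>v r" using r by (auto simp: algebra_simps)
    then show ?case
      using mult_in[OF r(3) Suc] eichler_add_orthogonal[OF p r(1), of "int n \<cdot>\<^sub>v r"] r p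
      by simp
  qed
  show ?thesis
  proof (cases "m \<ge> 0")
    case True
    then show ?thesis using nat[OF q orth E, of "nat m"] by simp
  next
    case False
    then have "m \<cdot>\<^sub>v q = int (nat (- m)) \<cdot>\<^sub>v (- q)" using q by auto
    then show ?thesis
      using nat[of "- q" "nat (- m)"] eichler_uminus_in[OF p q orth E] p q orth by simp
  qed
qed

end

section \<open>Generation by elementary matrices\<close>

text \<open>Coordinates below \<open>g\<close> form the \<open>e\<close> half, the others the
  \<open>f\<close> half; \<open>i mod g\<close> is the handle of coordinate \<open>i\<close>, and
  its dual is the other coordinate of that handle.\<close>

definition dual_index :: "nat \<Rightarrow> nat \<Rightarrow> nat" where
  "dual_index g i = (if i < g then g + i else i - g)"

text \<open>The sign that appears when a vector is paired with the unit vector at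
  \<open>i\<close>.\<close>

definition dual_sign :: "nat \<Rightarrow> nat \<Rightarrow> int" where
  "dual_sign g i = (if i < g then - 1 else 1)"

lemma dual_index_simps [simp]:
  assumes "i < 2 * g"
  shows "dual_index g i < 2 * g" "dual_index g (dual_index g i) = i"
    "dual_index g i \<noteq> i" "dual_index g i mod g = i mod g"
    "dual_sign g (dual_index g i) = - dual_sign g i"
  using assms by (auto simp: dual_index_def dual_sign_def mod_if)

lemma dual_index_eqI:
  assumes "i < 2 * g" "j < 2 * g" "i mod g = j mod g" "i \<noteq> j"
  shows "j = dual_index g i"
  using assms by (auto simp: dual_index_def mod_if split: if_splits)

lemma dual_sign_square [simp]: "dual_sign g i * (dual_sign g i * x) = x"
  by (simp add: dual_sign_def)

lemma omega_unit_vec: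
  assumes "v \<in> carrier_vec (2 * g)" "i < 2 * g"
  shows "omega g v (unit_vec (2 * g) i) = dual_sign g i * v $ dual_index g i"
  using assms by (simp add: omega_unit_right dual_index_def dual_sign_def)

lemma index_eq_omega:
  assumes "v \<in> carrier_vec (2 * g)" "i < 2 * g"
  shows "v $ i = - dual_sign g i * omega g v (unit_vec (2 * g) (dual_index g i))"
  using assms by (simp add: omega_unit_vec)

text \<open>The sum norm, used as termination measure of the Euclidean reduction.\<close>

definition vec_size :: "nat \<Rightarrow> int vec \<Rightarrow> nat" where
  "vec_size g v = (\<Sum>i<2 * g. nat \<bar>v $ i\<bar>)"

lemma vec_size_less:
  assumes "j < 2 * g" "\<bar>w $ j\<bar> < \<bar>v $ j\<bar>" "\<And>i. i < 2 * g \<Longrightarrow> i \<noteq> j \<Longrightarrow> w $ i = v $ i"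
  shows "vec_size g w < vec_size g v"
  unfolding vec_size_def
proof (rule sum_strict_mono_ex1)
  show "\<forall>i\<in>{..<2 * g}. nat \<bar>w $ i\<bar> \<le> nat \<bar>v $ i\<bar>"
    using assms by (metis lessThan_iff nat_le_eq_zle order_le_less order_refl nat_mono)
  show "\<exists>i\<in>{..<2 * g}. nat \<bar>w $ i\<bar> < nat \<bar>v $ i\<bar>"
    using assms by (intro bexI[of _ j]) auto
qed simp

section \<open>Row reduction by elementary matrices\<close>

locale elementary_subgroup = Sp_subgroup +
  assumes transvection_unit_in: "i < 2 * g \<Longrightarrow> transvection g 1 (unit_vec (2 * g) i) \<in> H"
    and eichler_unit_in: "i < 2 * g \<Longrightarrow> j < 2 * g \<Longrightarrow> i mod g \<noteq> j mod g \<Longrightarrow>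
      eichler g (unit_vec (2 * g) i) (unit_vec (2 * g) j) \<in> H"
begin

abbreviation u :: "nat \<Rightarrow> int vec" where
  "u i \<equiv> unit_vec (2 * g) i"

abbreviation V :: "int vec set" where
  "V \<equiv> carrier_vec (2 * g)"

text \<open>Handles below \<open>k\<close> count as already treated; later moves must not disturb
  them.\<close>

definition fixes_below :: "nat \<Rightarrow> int mat \<Rightarrow> bool" where
  "fixes_below k A \<longleftrightarrow> (\<forall>i<2 * g. i mod g < k \<longrightarrow> A *\<^sub>v u i = u i)"

lemma fixes_below_mult:
  assumes "A \<in> carrier (Sp_int g)" "B \<in> carrier (Sp_int g)" "fixes_below k A" "fixes_below k B"
  shows "fixes_below k (A * B)"
  using assms Sp_int_carrier_mat by (auto simp: fixes_below_def square_vec_assoc[of _ g])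

lemma omega_unit_unit:
  assumes "i < 2 * g" "j < 2 * g"
  shows "omega g (u i) (u j) = (if i = dual_index g j then dual_sign g j else 0)"
  using assms by (auto simp: omega_unit_vec)

lemma omega_unit_unit_zero:
  assumes "i < 2 * g" "j < 2 * g" "i mod g \<noteq> j mod g"
  shows "omega g (u i) (u j) = 0"
  using assms by (auto simp: omega_unit_unit)

text \<open>Inside a handle a transvection along \<open>u j\<close> serves, between handles an
  Eichler transformation. The latter also changes coordinate \<open>dual_index g i\<close> by a
  multiple of \<open>v $ dual_index g j\<close>, which the assumption \<open>dual\<close> makes
  zero.\<close>

lemma add_coordinate:
  assumes i: "i < 2 * g" "k \<le> i mod g" and j: "j < 2 * g" "k \<le> j mod g" and ij: "i \<noteq> j"
    and v: "v \<in> V" and dual: "j = dual_index g i \<or> v $ dual_index g j = 0"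
  shows "\<exists>h\<in>H. fixes_below k h \<and> h *\<^sub>v v = v + (m * v $ i) \<cdot>\<^sub>v u j"
proof (cases "j = dual_index g i")
  case True
  \<comment> \<open>Pairing \<open>v\<close> with \<open>u j\<close> gives
    \<open>dual_sign g j * v $ i\<close>; the factor \<open>dual_sign g j\<close> cancels this
    sign.\<close>
  let ?h = "transvection g (dual_sign g j * m) (u j)"
  have "?h \<in> H"
    using transvection_multiple_in[OF unit_vec_carrier transvection_unit_in[OF j(1)]] by simp
  moreover have "fixes_below k ?h"
    using i j True by (auto simp: fixes_below_def transvection_mult_vec omega_unit_unit)
  moreover have "?h *\<^sub>v v = v + (m * v $ i) \<cdot>\<^sub>v u j"
    using i j v True by (simp add: transvection_mult_vec omega_unit_vec mult.assoc mult.left_commute)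
  ultimately show ?thesis by blast
next
  case False
  then have neq: "dual_index g i mod g \<noteq> j mod g"
    using dual_index_eqI[of i g j] i j ij by auto
  \<comment> \<open>The sign again undoes that of the pairing, here with
    \<open>u (dual_index g i)\<close>.\<close>
  let ?c = "- dual_sign g i * m"
  let ?h = "eichler g (u (dual_index g i)) (?c \<cdot>\<^sub>v u j)"
  have orth: "omega g (u (dual_index g i)) (u j) = 0"
    using neq i j by (intro omega_unit_unit_zero) auto
  have "?h \<in> H"
    using i j neq by (intro eichler_multiple_in eichler_unit_in orth) auto
  moreover have "fixes_below k ?h"
    using i j by (auto simp: fixes_below_def eichler_mult_vec omega_unit_unit)
  moreover have "?h *\<^sub>v v = v + (m * v $ i) \<cdot>\<^sub>v u j"
    using i j v dual False
    by (intro eq_vecI) (auto simp: eichler_mult_vec omega_unit_vec simp del: index_mult_mat_vec)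
  ultimately show ?thesis by blast
qed

text \<open>Two additions suffice: \<open>c\<close> times coordinate \<open>i\<close> creates the
  entry \<open>c * c = 1\<close> at \<open>j\<close>, and this 1 then clears coordinate
  \<open>i\<close>.\<close>

lemma move_unit:
  assumes i: "i < 2 * g" "k \<le> i mod g" and j: "j < 2 * g" "k \<le> j mod g" and ij: "i \<noteq> j"
    and c: "\<bar>c\<bar> = 1"
  shows "\<exists>h\<in>H. fixes_below k h \<and> h *\<^sub>v (c \<cdot>\<^sub>v u i) = u j"
proof -
  have cc: "c * c = 1" using c by (auto simp: abs_if split: if_splits)
  have "j = dual_index g i \<or> (c \<cdot>\<^sub>v u i) $ dual_index g j = 0"
    using i j by auto
  from add_coordinate[OF i j ij _ this, of c]
  obtain h1 where h1: "h1 \<in> H" "fixes_below k h1" "h1 *\<^sub>v (c \<cdot>\<^sub>v u i) = c \<cdot>\<^sub>v u i + u j"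
    using i cc by auto
  have "i = dual_index g j \<or> (c \<cdot>\<^sub>v u i + u j) $ dual_index g i = 0"
    using i j by auto
  from add_coordinate[OF j i ij[symmetric] _ this, of "- c"]
  obtain h2 where h2: "h2 \<in> H" "fixes_below k h2"
    "h2 *\<^sub>v (c \<cdot>\<^sub>v u i + u j) = c \<cdot>\<^sub>v u i + u j + (- c) \<cdot>\<^sub>v u i"
    using i j ij by auto
  have "h2 * h1 \<in> H" "fixes_below k (h2 * h1)"
    using h1 h2 mult_in fixes_below_mult in_Sp by auto
  moreover have "(h2 * h1) *\<^sub>v (c \<cdot>\<^sub>v u i) = u j"
  proof -
    have "(h2 * h1) *\<^sub>v (c \<cdot>\<^sub>v u i) = c \<cdot>\<^sub>v u i + u j + (- c) \<cdot>\<^sub>v u i"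
      using h1 h2 in_Sp Sp_int_carrier_mat by (simp add: square_vec_assoc[of _ g])
    also have "\<dots> = u j" by (intro eq_vecI) auto
    finally show ?thesis .
  qed
  ultimately show ?thesis by blast
qed

text \<open>Euclidean algorithm: if some handle carries two nonzero coordinates, reduce one by the other;
  otherwise the dual of every nonzero coordinate vanishes, which is the side condition for reducing
  coordinates of different handles.\<close>

lemma primitive_to_unit:
  assumes "k < g" "v \<in> V" "\<And>i. i < 2 * g \<Longrightarrow> i mod g < k \<Longrightarrow> v $ i = 0"
    and "\<exists>w\<in>V. omega g v w = 1"
  shows "\<exists>h\<in>H. fixes_below k h \<and> h *\<^sub>v v = u k"
  using assms(2-)
proof (induction "vec_size g v" arbitrary: v rule: less_induct)
  case less
  note v = \<open>v \<in> V\<close> and low = less.prems(2)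
  have high: "k \<le> i mod g" if "i < 2 * g" "v $ i \<noteq> 0" for i
    using low[OF that(1)] that(2) by (meson not_le)
  have reduce: ?case
    if i: "i < 2 * g" "v $ i \<noteq> 0" and j: "j < 2 * g" "v $ j \<noteq> 0" and ij: "i \<noteq> j"
      and le: "\<bar>v $ i\<bar> \<le> \<bar>v $ j\<bar>" and dual: "j = dual_index g i \<or> v $ dual_index g j = 0" for i j
  proof -
    \<comment> \<open>The sign makes \<open>m * v $ i\<close> opposite to \<open>v $ j\<close>, so
      coordinate \<open>j\<close> strictly shrinks in absolute value.\<close>
    define m :: int where "m = (if (v $ i > 0) = (v $ j > 0) then - 1 else 1)"
    obtain h where h: "h \<in> H" "fixes_below k h" "h *\<^sub>v v = v + (m * v $ i) \<cdot>\<^sub>v u j"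
      using add_coordinate[OF i(1) high[OF i] j(1) high[OF j] ij v dual] by blast
    note hm = Sp_int_carrier_mat[OF in_Sp[OF h(1)]]
    have index: "(h *\<^sub>v v) $ l = v $ l + (if l = j then m * v $ i else 0)" if "l < 2 * g" for l
      using that j v by (auto simp: h(3) simp del: index_mult_mat_vec)
    have "vec_size g (h *\<^sub>v v) < vec_size g v"
    proof (rule vec_size_less[OF j(1)])
      show "\<bar>(h *\<^sub>v v) $ j\<bar> < \<bar>v $ j\<bar>"
        using i(2) j le by (auto simp: index m_def abs_if split: if_splits)
    qed (simp add: index)
    moreover have "(h *\<^sub>v v) $ l = 0" if "l < 2 * g" "l mod g < k" for l
      using low[OF that] high[OF j] that by (auto simp: index)
    \<comment> \<open>Primitivity survives because the witness is moved along by
      \<open>h\<close>.\<close>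
    moreover have "\<exists>w\<in>V. omega g (h *\<^sub>v v) w = 1"
    proof -
      obtain w where w: "w \<in> V" "omega g v w = 1" using less.prems(3) by blast
      then show ?thesis
        using Sp_int_omega[OF in_Sp[OF h(1)] v w(1)] hm
        by (intro bexI[of _ "h *\<^sub>v w"]) auto
    qed
    moreover have "h *\<^sub>v v \<in> V" using hm v by simp
    ultimately obtain h' where h': "h' \<in> H" "fixes_below k h'" "h' *\<^sub>v (h *\<^sub>v v) = u k"
      using less.hyps by blast
    then show ?thesis
      using h hm v mult_in fixes_below_mult in_Sp Sp_int_carrier_mat[OF in_Sp[OF h'(1)]]
      by (intro bexI[of _ "h' * h"]) (auto simp: square_vec_assoc[of _ g])
  qed
  obtain w where w: "w \<in> V" "omega g v w = 1" using less.prems(3) by blast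
  have "\<exists>i<2 * g. v $ i \<noteq> 0"
  proof (rule ccontr)
    assume "\<not> ?thesis"
    then have "v = 0\<^sub>v (2 * g)" using v by (intro eq_vecI) auto
    then show False using w omega_zero_right[of w g] omega_antisym[of w g v] v by simp
  qed
  then obtain i where i: "i < 2 * g" "v $ i \<noteq> 0" by blast
  show ?case
  proof (cases "\<exists>j<2 * g. j \<noteq> i \<and> v $ j \<noteq> 0")
    case True
    show ?thesis
    proof (cases "\<exists>j<2 * g. v $ j \<noteq> 0 \<and> v $ dual_index g j \<noteq> 0")
      case True
      then obtain j where j: "j < 2 * g" "v $ j \<noteq> 0" "v $ dual_index g j \<noteq> 0" by blast
      show ?thesis
        using reduce[of j "dual_index g j"] reduce[of "dual_index g j" j] j
          dual_index_simps[OF j(1)] by (metis linorder_le_cases)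
    next
      case False
      obtain j where j: "j < 2 * g" "v $ j \<noteq> 0" "j \<noteq> i" using True by blast
      then show ?thesis
        using reduce[of j i] reduce[of i j] i False by (metis linorder_le_cases)
    qed
  next
    case False
    then have vi: "v = v $ i \<cdot>\<^sub>v u i"
      using i v by (intro eq_vecI) auto
    \<comment> \<open>With a single nonzero coordinate left, primitivity forces it to be a
      unit.\<close>
    have "v $ i * omega g (u i) w = 1"
      using w(2) omega_smult_left[of "u i" g w "v $ i"] w(1) vi by (metis unit_vec_carrier)
    then have c: "\<bar>v $ i\<bar> = 1"
      using abs_zmult_eq_1[of "v $ i" "omega g (u i) w"] by simp
    have kk: "k < 2 * g" "k \<le> k mod g" "g + k < 2 * g" "k \<le> (g + k) mod g"
      using \<open>k < g\<close> by auto
    show ?thesis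
    proof (cases "i = k")
      case False
      then show ?thesis
        using move_unit[OF i(1) high[OF i] kk(1,2) _ c] vi by metis
    next
      \<comment> \<open>\<open>move_unit\<close> needs distinct indices, so a coordinate already in
        place, possibly with the wrong sign, takes a detour through its dual
        \<open>g + k\<close>.\<close>
      case True
      obtain h1 where h1: "h1 \<in> H" "fixes_below k h1" "h1 *\<^sub>v v = u (g + k)"
        using move_unit[OF i(1) high[OF i] kk(3,4) _ c] True vi \<open>k < g\<close> by (metis add_cancel_left_left not_less_zero)
      obtain h2 where h2: "h2 \<in> H" "fixes_below k h2" "h2 *\<^sub>v (1 \<cdot>\<^sub>v u (g + k)) = u k"
        using move_unit[OF kk(3,4,1,2), of 1] \<open>k < g\<close> by auto
      show ?thesis
        using h1 h2 v mult_in fixes_below_mult in_Sp Sp_int_carrier_mat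
        by (intro bexI[of _ "h2 * h1"]) (auto simp: square_vec_assoc[of _ g])
    qed
  qed
qed

section \<open>Fixing one handle after another\<close>

lemma fixes_below_Suc:
  assumes "fixes_below k A" "A *\<^sub>v u k = u k" "A *\<^sub>v u (g + k) = u (g + k)" "k < g"
  shows "fixes_below (Suc k) A"
  unfolding fixes_below_def
proof (intro allI impI)
  fix i assume i: "i < 2 * g" "i mod g < Suc k"
  show "A *\<^sub>v u i = u i"
  proof (cases "i mod g < k")
    case True
    then show ?thesis using assms(1) i by (simp add: fixes_below_def)
  next
    case False
    then have "i mod g = k mod g" using i \<open>k < g\<close> by simp
    then have "i = k \<or> i = dual_index g k"
      using dual_index_eqI[of k g i] i \<open>k < g\<close> by linarith
    then show ?thesis using assms by (auto simp: dual_index_def)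
  qed
qed

text \<open>\<open>A\<close> fixes the lower unit vectors and preserves the pairing, so the image of
  \<open>u j\<close> stays orthogonal to them; these pairings are its lower coordinates up to
  sign.\<close>

lemma low_coordinates_zero:
  assumes A: "A \<in> carrier (Sp_int g)" "fixes_below k A"
    and j: "j < 2 * g" "k \<le> j mod g" and i: "i < 2 * g" "i mod g < k"
  shows "omega g (A *\<^sub>v u j) (u i) = 0" "(A *\<^sub>v u j) $ i = 0"
proof -
  have *: "omega g (A *\<^sub>v u j) (u l) = 0" if l: "l < 2 * g" "l mod g < k" for l
  proof -
    have "A *\<^sub>v u l = u l" using A(2) l by (simp add: fixes_below_def)
    then have "omega g (A *\<^sub>v u j) (u l) = omega g (u j) (u l)"
      using Sp_int_omega[OF A(1), of "u j" "u l"] by simp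
    then show ?thesis using j l by (auto simp: omega_unit_unit)
  qed
  show "omega g (A *\<^sub>v u j) (u i) = 0" by (rule *[OF i])
  have "A *\<^sub>v u j \<in> V" using Sp_int_carrier_mat[OF A(1)] by simp
  then show "(A *\<^sub>v u j) $ i = 0"
    using index_eq_omega[of "A *\<^sub>v u j" g i] *[of "dual_index g i"] i by simp
qed

text \<open>The Euclidean reduction restores \<open>?e\<close>; then the image of \<open>?f\<close>
  is restored by transvections fixing \<open>?e\<close> and the lower handles.\<close>

lemma extend_fixed:
  assumes k: "k < g" and A: "A \<in> carrier (Sp_int g)" "fixes_below k A"
  shows "\<exists>h\<in>H. fixes_below (Suc k) (h * A)"
proof -
  let ?e = "u k" and ?f = "u (g + k)"
  have ek: "k < 2 * g" "k \<le> k mod g" and fk: "g + k < 2 * g" "k \<le> (g + k) mod g"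
    using k by auto
  have ef: "omega g ?e ?f = 1" "omega g ?f ?e = - 1"
    using k by (auto simp: omega_unit_unit dual_index_def dual_sign_def)
  have "\<exists>h\<in>H. fixes_below k h \<and> h *\<^sub>v (A *\<^sub>v ?e) = ?e"
  proof (rule primitive_to_unit[OF k])
    show "A *\<^sub>v ?e \<in> V" using Sp_int_carrier_mat[OF A(1)] by simp
    show "(A *\<^sub>v ?e) $ i = 0" if "i < 2 * g" "i mod g < k" for i
      by (rule low_coordinates_zero(2)[OF A ek that])
    show "\<exists>w\<in>V. omega g (A *\<^sub>v ?e) w = 1"
      using Sp_int_omega[OF A(1), of ?e ?f] ef Sp_int_carrier_mat[OF A(1)]
      by (intro bexI[of _ "A *\<^sub>v ?f"]) auto
  qed
  then obtain h1 where h1: "h1 \<in> H" "fixes_below k h1" "h1 *\<^sub>v (A *\<^sub>v ?e) = ?e" by blast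
  define B where "B = h1 * A"
  have B: "B \<in> carrier (Sp_int g)" "fixes_below k B" "B *\<^sub>v ?e = ?e"
    using h1 A in_Sp fixes_below_mult m_closed[of h1 A] Sp_int_carrier_mat[OF A(1)]
      Sp_int_carrier_mat[OF in_Sp[OF h1(1)]]
    by (auto simp: B_def square_vec_assoc[of _ g])
  \<comment> \<open>Since \<open>B *\<^sub>v ?f\<close> pairs to \<open>- 1\<close> with
    \<open>?e\<close>, the transvection \<open>t\<close> subtracts \<open>m\<close> times
    \<open>?e\<close> from it, which adds \<open>m\<close> to its pairing with \<open>?f\<close>.
    This \<open>m\<close> makes that pairing 1.\<close>
  define m where "m = 1 - omega g ?f (B *\<^sub>v ?f)"
  define t where "t = transvection g m ?e"
  have t: "t \<in> H" "fixes_below k t" "t *\<^sub>v ?e = ?e"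
    using transvection_multiple_in[OF unit_vec_carrier transvection_unit_in[OF ek(1)], of m] ek
    by (auto simp: t_def fixes_below_def transvection_mult_vec omega_unit_unit)
  define C where "C = t * B"
  have C: "C \<in> carrier (Sp_int g)" "fixes_below k C" "C *\<^sub>v ?e = ?e"
    using t B in_Sp fixes_below_mult m_closed[of t B] Sp_int_carrier_mat[OF B(1)]
      Sp_int_carrier_mat[OF in_Sp[OF t(1)]]
    by (auto simp: C_def square_vec_assoc[of _ g])
  define w where "w = C *\<^sub>v ?f"
  have w: "w \<in> V" using Sp_int_carrier_mat[OF C(1)] by (simp add: w_def)
  have ew: "omega g ?e w = 1"
    using Sp_int_omega[OF C(1), of ?e ?f] ef C(3) by (simp add: w_def)
  have fw: "omega g ?f w = 1"
  proof -
    have Bf: "B *\<^sub>v ?f \<in> V" using Sp_int_carrier_mat[OF B(1)] by simp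
    have "omega g (B *\<^sub>v ?f) ?e = - 1"
      using Sp_int_omega[OF B(1), of ?f ?e] ef B(3) by simp
    then have "w = B *\<^sub>v ?f + (- m) \<cdot>\<^sub>v ?e"
      using Bf Sp_int_carrier_mat[OF B(1)]
      by (simp add: w_def C_def t_def square_vec_assoc[of _ g] transvection_mult_vec)
    then show ?thesis using Bf ef by (simp add: m_def)
  qed
  \<comment> \<open>As \<open>omega g ?f w = 1\<close>, the transvection along \<open>w - ?f\<close> carries \<open>?f\<close> to \<open>w\<close>.\<close>
  define p where "p = w - ?f"
  have p: "p \<in> V" using w by (simp add: p_def)
  have wp: "w = ?f + p" using w by (auto simp: p_def)
  have ep: "omega g ?e p = 0" using ew ef p by (simp add: wp)
  have fp: "omega g ?f p = 1" using fw p by (simp add: wp)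
  have plow: "omega g p (u i) = 0" if i: "i < 2 * g" "i mod g < k" for i
  proof -
    have "omega g w (u i) = 0" unfolding w_def by (rule low_coordinates_zero(1)[OF C(1,2) fk i])
    moreover have "omega g ?f (u i) = 0" using fk i by (intro omega_unit_unit_zero) auto
    ultimately show ?thesis using p by (simp add: wp)
  qed
  \<comment> \<open>\<open>p\<close> is primitive without lower coordinates, so its transvection is
    conjugate under \<open>H\<close> to an elementary one.\<close>
  have "\<exists>h\<in>H. fixes_below k h \<and> h *\<^sub>v p = u k"
  proof (rule primitive_to_unit[OF k p])
    show "p $ i = 0" if "i < 2 * g" "i mod g < k" for i
      using index_eq_omega[OF p that(1)] plow[of "dual_index g i"] that by simp
    show "\<exists>w\<in>V. omega g p w = 1"
      using fp omega_antisym[of ?f g p] p by (intro bexI[of _ "- ?f"]) auto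
  qed
  then obtain h2 where "h2 \<in> H" "h2 *\<^sub>v p = u k" by blast
  then have "transvection g 1 p \<in> H"
    using transvection_conj_inv_in[of h2 p 1] p transvection_unit_in[OF ek(1)] by simp
  then have s: "transvection g (- 1) p \<in> H"
    using transvection_multiple_in[OF p, of 1 "- 1"] by simp
  let ?D = "transvection g (- 1) p * C"
  have fixp: "transvection g (- 1) p *\<^sub>v u i = u i" if "i < 2 * g" "i mod g < k" for i
    using plow[OF that] omega_antisym[of "u i" g p] p by (auto simp: transvection_mult_vec)
  have "fixes_below (Suc k) ?D"
  proof (rule fixes_below_Suc[OF _ _ _ k])
    show "fixes_below k ?D"
      using fixp C s in_Sp by (intro fixes_below_mult) (auto simp: fixes_below_def)
    show "?D *\<^sub>v ?e = ?e"
      using Sp_int_carrier_mat[OF C(1)] C(3) ep p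
      by (auto simp: square_vec_assoc[of _ g] transvection_mult_vec)
    have "omega g w p = 1" using p fp by (simp add: wp)
    then have "transvection g (- 1) p *\<^sub>v w = w + (- 1) \<cdot>\<^sub>v p"
      using w p by (simp add: transvection_mult_vec)
    also have "\<dots> = ?f" using p unfolding wp by (intro eq_vecI) auto
    finally show "?D *\<^sub>v ?f = ?f"
      using Sp_int_carrier_mat[OF C(1)] by (simp add: square_vec_assoc[of _ g] w_def)
  qed
  moreover have "?D = (transvection g (- 1) p * t * h1) * A"
    using A(1) h1(1) t(1) in_Sp Sp_int_carrier_mat
    by (simp add: C_def B_def square_assoc[of _ g])
  moreover have "transvection g (- 1) p * t * h1 \<in> H"
    using s t h1 mult_in by blast
  ultimately show ?thesis by metis
qed

text \<open>Treating the handles in turn by factors from \<open>H\<close> leaves a matrix fixing all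
  unit vectors, which is the identity.\<close>

lemma eq_Sp: "H = carrier (Sp_int g)"
proof -
  have "A \<in> H" if "A \<in> carrier (Sp_int g)" "fixes_below k A" "k \<le> g" for k A
    using that
  proof (induction "g - k" arbitrary: k A)
    case 0
    then have "fixes_below g A" by (metis diff_is_0_eq le_antisym)
    then have "A *\<^sub>v u i = u i" if "i < 2 * g" for i
      using that mod_less_divisor[of g i] by (simp add: fixes_below_def)
    then have "A = 1\<^sub>m (2 * g)"
    proof (intro eq_matI)
      fix i j assume "i < dim_row (1\<^sub>m (2 * g) :: int mat)" "j < dim_col (1\<^sub>m (2 * g) :: int mat)"
      then have ij: "i < 2 * g" "j < 2 * g" by auto
      have "A $$ (i, j) = (A *\<^sub>v u j) $ i"
        using ij Sp_int_carrier_mat[OF 0(2)] by simp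
      also have "\<dots> = 1\<^sub>m (2 * g) $$ (i, j)"
        using ij \<open>\<And>i. i < 2 * g \<Longrightarrow> A *\<^sub>v u i = u i\<close>[OF ij(2)] by simp
      finally show "A $$ (i, j) = 1\<^sub>m (2 * g) $$ (i, j)" .
    qed (use Sp_int_carrier_mat[OF 0(2)] in auto)
    then show ?case using one_in by simp
  next
    case (Suc n)
    then have k: "k < g" by simp
    obtain h where h: "h \<in> H" "fixes_below (Suc k) (h * A)"
      using extend_fixed[OF k Suc.prems(1,2)] by blast
    have "h * A \<in> carrier (Sp_int g)"
      using m_closed[OF in_Sp[OF h(1)] Suc.prems(1)] by simp
    then have "h * A \<in> H"
      using Suc.hyps(1)[of "Suc k" "h * A"] Suc.hyps(2) h k by simp
    then show ?case using cancel_left[OF h(1)] Suc.prems(1) by blast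
  qed
  \<comment> \<open>For \<open>k = 0\<close> the condition \<open>fixes_below\<close> is
    vacuous.\<close>
  from this[of _ 0] have "carrier (Sp_int g) \<subseteq> H" by (auto simp: fixes_below_def)
  then show ?thesis using in_Sp by auto
qed

end

section \<open>The two generators\<close>

text \<open>Handles are indexed by integers modulo \<open>g\<close>, so shifts and offsets such as
  \<open>i + 4\<close> need no wrap-around cases.\<close>

definition e_vec :: "nat \<Rightarrow> int \<Rightarrow> int vec" where
  "e_vec g i = unit_vec (2 * g) (nat (i mod int g))"

definition f_vec :: "nat \<Rightarrow> int \<Rightarrow> int vec" where
  "f_vec g i = unit_vec (2 * g) (g + nat (i mod int g))"

definition handle_shift :: "nat \<Rightarrow> int mat" where
  "handle_shift g = mat (2 * g) (2 * g) (\<lambda>(i, j).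
     if i = (if j < g then Suc j mod g else g + Suc (j - g) mod g) then 1 else 0)"

text \<open>In the basis \<open>e_vec g i\<close>, \<open>f_vec g i\<close> of the handle this is
  the block with rows \<open>(n, -1)\<close> and \<open>(1, 0)\<close>, of determinant 1.\<close>

definition handle_matrix :: "nat \<Rightarrow> int \<Rightarrow> int \<Rightarrow> int mat" where
  "handle_matrix g n i = rank2 g (e_vec g i) (f_vec g i) 1 (n - 1) 1 1"

text \<open>The index \<open>i\<close> covers the conjugates of the generator, which is the case
  \<open>i = 0\<close>, by powers of the shift. The offset 4 keeps the local factor away from the
  Eichler factors of adjacent conjugates.\<close>

definition second_generator :: "nat \<Rightarrow> int \<Rightarrow> int \<Rightarrow> int mat" where
  "second_generator g n i = eichler g (e_vec g i) (f_vec g (i + 1)) * handle_matrix g n (i + 4)"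

lemma e_f_vec_carrier [simp]:
  "e_vec g i \<in> carrier_vec (2 * g)" "f_vec g i \<in> carrier_vec (2 * g)"
  by (simp_all add: e_vec_def f_vec_def)

lemma e_f_vec_dim [simp]: "dim_vec (e_vec g i) = 2 * g" "dim_vec (f_vec g i) = 2 * g"
  by (simp_all add: e_vec_def f_vec_def)

lemma e_f_vec_add_period [simp]:
  "e_vec g (i + int g) = e_vec g i" "f_vec g (i + int g) = f_vec g i"
  by (simp_all add: e_vec_def f_vec_def)

section \<open>The generators acting on the symplectic basis\<close>

locale genus =
  fixes g :: nat
  assumes genus: "g \<ge> 8"
begin

lemma nat_mod_less: "nat (i mod int g) < g"
  using genus by (simp add: nat_less_iff)

lemma nat_mod_eq_iff: "nat (i mod int g) = nat (j mod int g) \<longleftrightarrow> int g dvd i - j"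
  using genus by (simp add: eq_nat_nat_iff mod_eq_dvd_iff)

lemma omega_handle [simp]:
  "omega g (e_vec g i) (e_vec g j) = 0" "omega g (f_vec g i) (f_vec g j) = 0"
  "omega g (e_vec g i) (f_vec g j) = (if int g dvd i - j then 1 else 0)"
  "omega g (f_vec g i) (e_vec g j) = (if int g dvd i - j then - 1 else 0)"
  using nat_mod_less[of i] nat_mod_less[of j] nat_mod_eq_iff[of i j]
  by (auto simp: e_vec_def f_vec_def omega_unit_right)

text \<open>Handles at positive distance below 8 are distinct as \<open>g\<close> is at least 8; the
  first clause covers distance 1. This settles the numeral side conditions of the calculations
  below.\<close>

lemma small_not_dvd [simp]: "g \<noteq> Suc 0" "numeral m < (8 :: int) \<Longrightarrow> \<not> int g dvd numeral m"
proof -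
  show "\<not> int g dvd numeral m" if "numeral m < (8 :: int)"
    using that genus zdvd_imp_le[OF _ zero_less_numeral, of "int g" m] by linarith
qed (use genus in simp)

lemma handle_shift_carrier_mat: "handle_shift g \<in> carrier_mat (2 * g) (2 * g)"
  by (simp add: handle_shift_def)

lemma handle_shift_unit:
  assumes "j < 2 * g"
  shows "handle_shift g *\<^sub>v unit_vec (2 * g) j =
    unit_vec (2 * g) (if j < g then Suc j mod g else g + Suc (j - g) mod g)"
proof (rule eq_vecI)
  have "Suc l mod g < g" "Suc l mod g < 2 * g" for l
    using genus mod_less_divisor[of g "Suc l"] by linarith+
  moreover fix i assume "i < dim_vec (unit_vec (2 * g) (if j < g then Suc j mod g else g + Suc (j - g) mod g) :: int vec)"
  ultimately show "(handle_shift g *\<^sub>v unit_vec (2 * g) j) $ i =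
      unit_vec (2 * g) (if j < g then Suc j mod g else g + Suc (j - g) mod g) $ i"
    using assms by (auto simp: handle_shift_def)
qed (simp add: handle_shift_def)

lemma nat_mod_Suc: "Suc (nat (i mod int g)) mod g = nat ((i + 1) mod int g)"
proof -
  have "int (Suc (nat (i mod int g)) mod g) = (i mod int g + 1) mod int g"
    using genus by (simp add: zmod_int add.commute)
  also have "\<dots> = (i + 1) mod int g" by (simp add: mod_simps)
  finally show ?thesis by simp
qed

lemma handle_shift_e_f [simp]:
  "handle_shift g *\<^sub>v e_vec g i = e_vec g (i + 1)" "handle_shift g *\<^sub>v f_vec g i = f_vec g (i + 1)"
  using nat_mod_less[of i] nat_mod_Suc[of i] by (auto simp: e_vec_def f_vec_def handle_shift_unit)

lemma unit_vec_handle: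
  "i < 2 * g \<Longrightarrow> unit_vec (2 * g) i = (if i < g then e_vec g (int i) else f_vec g (int (i - g)))"
  by (auto simp: e_vec_def f_vec_def zmod_int[symmetric] mod_if)

lemma handle_shift_Sp: "handle_shift g \<in> carrier (Sp_int g)"
  by (intro Sp_int_unitI handle_shift_carrier_mat) (simp_all add: unit_vec_handle)

lemma handle_matrix_Sp: "handle_matrix g n i \<in> carrier (Sp_int g)"
  unfolding handle_matrix_def by (intro rank2_Sp) auto

lemma handle_matrix_e_f [simp]:
  "handle_matrix g n i *\<^sub>v e_vec g i = n \<cdot>\<^sub>v e_vec g i + f_vec g i"
  "handle_matrix g n i *\<^sub>v f_vec g i = - e_vec g i"
  unfolding handle_matrix_def
  by (intro eq_vecI; simp add: rank2_mult_vec left_diff_distrib del: index_mult_mat_vec)+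

lemma handle_matrix_other [simp]:
  assumes "\<not> int g dvd j - i"
  shows "handle_matrix g n i *\<^sub>v e_vec g j = e_vec g j" "handle_matrix g n i *\<^sub>v f_vec g j = f_vec g j"
  using assms unfolding handle_matrix_def by (auto simp: rank2_mult_vec)

lemma eichler_handle_Sp: "\<not> int g dvd i - j \<Longrightarrow> eichler g (e_vec g i) (f_vec g j) \<in> carrier (Sp_int g)"
  by (intro eichler_Sp) auto

lemma eichler_handle_e [simp]:
  "eichler g (e_vec g i) (f_vec g j) *\<^sub>v e_vec g k =
    (if int g dvd k - j then e_vec g k + e_vec g i else e_vec g k)"
  by (auto simp: eichler_mult_vec)

lemma eichler_handle_f [simp]:
  "eichler g (e_vec g i) (f_vec g j) *\<^sub>v f_vec g k =
    (if int g dvd k - i then f_vec g k + - f_vec g j else f_vec g k)"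
  by (auto simp: eichler_mult_vec)

lemma second_generator_Sp: "second_generator g n i \<in> carrier (Sp_int g)"
proof -
  interpret group "Sp_int g" by (rule Sp_int_group)
  show ?thesis
    using m_closed[OF eichler_handle_Sp[of i "i + 1"] handle_matrix_Sp[of n "i + 4"]]
    by (simp add: second_generator_def)
qed

lemma second_generator_mult_vec:
  assumes "v \<in> carrier_vec (2 * g)"
  shows "second_generator g n i *\<^sub>v v =
    eichler g (e_vec g i) (f_vec g (i + 1)) *\<^sub>v (handle_matrix g n (i + 4) *\<^sub>v v)"
  using assms Sp_int_carrier_mat[OF handle_matrix_Sp]
  by (simp add: second_generator_def square_vec_assoc[of _ g])

lemma second_generator_conj:
  assumes A: "A \<in> carrier (Sp_int g)"
  shows "A * second_generator g n i =
    (eichler g (A *\<^sub>v e_vec g i) (A *\<^sub>v f_vec g (i + 1)) *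
      rank2 g (A *\<^sub>v e_vec g (i + 4)) (A *\<^sub>v f_vec g (i + 4)) 1 (n - 1) 1 1) * A"
proof -
  note Am = Sp_int_carrier_mat[OF A]
  have "A * second_generator g n i =
      (A * eichler g (e_vec g i) (f_vec g (i + 1))) * handle_matrix g n (i + 4)"
    using Am Sp_int_carrier_mat[OF handle_matrix_Sp]
    by (simp add: second_generator_def square_assoc[of _ g])
  also have "\<dots> = eichler g (A *\<^sub>v e_vec g i) (A *\<^sub>v f_vec g (i + 1)) * (A * handle_matrix g n (i + 4))"
    using Am Sp_int_carrier_mat[OF handle_matrix_Sp] rank2_conj[OF A]
    by (simp add: eichler_def square_assoc[of _ g])
  also have "A * handle_matrix g n (i + 4) =
      rank2 g (A *\<^sub>v e_vec g (i + 4)) (A *\<^sub>v f_vec g (i + 4)) 1 (n - 1) 1 1 * A"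
    unfolding handle_matrix_def by (rule rank2_conj[OF A]) auto
  finally show ?thesis
    using Am by (simp add: square_assoc[of _ g])
qed

lemma handle_shift_conj:
  "handle_shift g * second_generator g n i = second_generator g n (i + 1) * handle_shift g"
  by (subst second_generator_conj[OF handle_shift_Sp])
    (simp add: second_generator_def handle_matrix_def add.commute add.left_commute)

end

section \<open>All elementary matrices from the two generators\<close>

locale two_generators = genus g + Sp_subgroup g H for g H +
  fixes n :: int
  assumes shift_in: "handle_shift g \<in> H"
    and second_in: "second_generator g n 0 \<in> H"
    and odd: "odd n"
begin

text \<open>Conjugation by the shift reaches every natural index, and periodicity modulo
  \<open>g\<close> the negative ones.\<close>

lemma second_generator_in: "second_generator g n i \<in> H"
proof -
  have "second_generator g n (int k) \<in> H" for k
  proof (induction k)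
    case 0
    then show ?case using second_in by simp
  next
    case (Suc k)
    then show ?case
      using conj_in[OF shift_in Suc handle_shift_conj second_generator_Sp] by (simp add: add.commute)
  qed
  from this[of "nat (i mod int g)"] have "second_generator g n (i mod int g) \<in> H"
    using genus by simp
  moreover have "e_vec g (i mod int g + c) = e_vec g (i + c)" "f_vec g (i mod int g + c) = f_vec g (i + c)" for c
    by (simp_all add: e_vec_def f_vec_def mod_simps)
  note this[of 0] this[of 1] this[of 4]
  ultimately show ?thesis
    by (simp add: second_generator_def handle_matrix_def)
qed

text \<open>The local factors of adjacent conjugates commute, so only the commutator of the two
  Eichler factors survives.\<close>

lemma eichler_step_two: "eichler g (e_vec g i) (f_vec g (i + 2)) \<in> H"
proof -
  let ?A = "second_generator g n i" and ?B = "second_generator g n (i + 1)"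
  have A: "?A \<in> H" and B: "?B \<in> H" by (rule second_generator_in)+
  \<comment> \<open>Among the vectors defining \<open>?B\<close>, only
    \<open>e_vec g (i + 1)\<close> is moved by \<open>?A\<close>.\<close>
  have vecs: "?A *\<^sub>v e_vec g (i + 1) = e_vec g (i + 1) + e_vec g i"
    "?A *\<^sub>v f_vec g (i + 2) = f_vec g (i + 2)"
    "?A *\<^sub>v e_vec g (i + 5) = e_vec g (i + 5)" "?A *\<^sub>v f_vec g (i + 5) = f_vec g (i + 5)"
    by (simp_all add: second_generator_mult_vec)
  have "?A * ?B = (eichler g (e_vec g (i + 1) + e_vec g i) (f_vec g (i + 2)) * handle_matrix g n (i + 5)) * ?A"
    using second_generator_conj[OF in_Sp[OF A], of n "i + 1"] vecs
    by (simp add: add.assoc handle_matrix_def)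
  also have "eichler g (e_vec g (i + 1) + e_vec g i) (f_vec g (i + 2)) =
      eichler g (e_vec g i) (f_vec g (i + 2)) * eichler g (e_vec g (i + 1)) (f_vec g (i + 2))"
  proof -
    let ?f = "f_vec g (i + 2)" and ?p = "e_vec g i" and ?q = "e_vec g (i + 1)"
    have "eichler g ?f ?p * eichler g ?f ?q = eichler g ?f (?p + ?q)"
      by (rule eichler_add_orthogonal) auto
    moreover have "eichler g ?f v = eichler g v ?f" if "v \<in> carrier_vec (2 * g)" for v
      using that by (intro eichler_commute) auto
    moreover have "?p + ?q = ?q + ?p" by (rule comm_add_vec[of _ "2 * g"]) auto
    ultimately show ?thesis by simp
  qed
  also have "\<dots> * handle_matrix g n (i + 5) = eichler g (e_vec g i) (f_vec g (i + 2)) * ?B"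
    using Sp_int_carrier_mat[OF handle_matrix_Sp]
    by (simp add: second_generator_def square_assoc[of _ g] add.assoc)
  \<comment> \<open>Conjugation by \<open>?A\<close> has put just this Eichler factor in front of
    \<open>?B\<close>.\<close>
  finally have "eichler g (e_vec g i) (f_vec g (i + 2)) * ?B \<in> H"
    using conj_in[OF A B] m_closed[OF eichler_handle_Sp[of i "i + 2"] in_Sp[OF B]] by simp
  then show ?thesis
    by (rule cancel_right[OF B]) (simp add: eichler_handle_Sp)
qed

text \<open>Conjugation by \<open>A\<close> turns the given element into the one for
  \<open>f_vec g j + - f_vec g k\<close>; dividing by the original leaves the part of
  \<open>f_vec g k\<close>.\<close>

lemma eichler_extend:
  assumes "eichler g (e_vec g i) (f_vec g j) \<in> H" "\<not> int g dvd i - j" "\<not> int g dvd i - k"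
    and A: "A \<in> H" "A *\<^sub>v e_vec g i = e_vec g i" "A *\<^sub>v f_vec g j = f_vec g j + - f_vec g k"
  shows "eichler g (e_vec g i) (f_vec g k) \<in> H"
proof -
  have "eichler g (e_vec g i) (f_vec g j + - f_vec g k) \<in> H"
    using eichler_conj_in[OF A(1), of "e_vec g i" "f_vec g j"] assms by simp
  then have "eichler g (e_vec g i) (- f_vec g k) \<in> H"
    using assms eichler_add_cancel_in[of "e_vec g i" "f_vec g j" "- f_vec g k"] by simp
  then show ?thesis
    using eichler_uminus_in[of "e_vec g i" "- f_vec g k"] assms(3) by simp
qed

text \<open>The Eichler factor of \<open>second_generator g n (i + 2)\<close> extends distance 2 by
  one; its local factor, at handle \<open>i + 6\<close>, touches neither vector.\<close>

lemma eichler_step_three: "eichler g (e_vec g i) (f_vec g (i + 3)) \<in> H"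
proof -
  have "eichler g (e_vec g i) (f_vec g (i + 2 + 1)) \<in> H"
  proof (rule eichler_extend[OF eichler_step_two _ _ second_generator_in[of "i + 2"]])
    show "second_generator g n (i + 2) *\<^sub>v e_vec g i = e_vec g i"
      by (simp add: second_generator_mult_vec)
    show "second_generator g n (i + 2) *\<^sub>v f_vec g (i + 2) = f_vec g (i + 2) + - f_vec g (i + 2 + 1)"
      by (simp add: second_generator_mult_vec)
  qed simp_all
  then show ?thesis by (simp add: add.assoc)
qed

text \<open>The extending element is the distance 2 one at \<open>i + d\<close>. It fixes
  \<open>e_vec g i\<close> because handle \<open>i + d + 2\<close> differs from handle
  \<open>i\<close>.\<close>

lemma eichler_two_steps:
  assumes "\<And>i. eichler g (e_vec g i) (f_vec g (i + d)) \<in> H" "\<not> int g dvd d" "\<not> int g dvd d + 2"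
  shows "eichler g (e_vec g i) (f_vec g (i + d + 2)) \<in> H"
  by (rule eichler_extend[OF assms(1) _ _ eichler_step_two[of "i + d"]])
    (use assms(2,3) dvd_minus_iff[of "int g" "d + 2"] in \<open>simp_all add: algebra_simps\<close>)

text \<open>Distances 2 and 3 start the two parity classes, which are then climbed by steps of
  two.\<close>

lemma eichler_any_step:
  assumes "2 \<le> d" "d < g"
  shows "eichler g (e_vec g i) (f_vec g (i + int d)) \<in> H"
  using assms
proof (induction d arbitrary: i rule: less_induct)
  case (less d)
  consider "d = 2" | "d = 3" | "d \<ge> 4" using less.prems by linarith
  then show ?case
  proof cases
    case 3
    then have "\<not> int g dvd int (d - 2)" "\<not> int g dvd int (d - 2) + 2"
      using less.prems zdvd_imp_le[of "int g" "int (d - 2)"] zdvd_imp_le[of "int g" "int (d - 2) + 2"]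
      by linarith+
    then have "eichler g (e_vec g i) (f_vec g (i + int (d - 2) + 2)) \<in> H"
      using 3 less.prems by (intro eichler_two_steps less.IH) auto
    moreover have "i + int (d - 2) + 2 = i + int d" using 3 by simp
    ultimately show ?thesis by (simp only:)
  qed (use eichler_step_two eichler_step_three in auto)
qed

text \<open>Modulo \<open>g\<close>, distance 1 is \<open>(g - 1) + 2\<close>: one more double step
  goes around the cycle of handles.\<close>

lemma eichler_one_step: "eichler g (e_vec g i) (f_vec g (i + 1)) \<in> H"
proof -
  have dvd: "\<not> int g dvd int (g - 1)" "\<not> int g dvd int (g - 1) + 2"
    using genus zdvd_imp_le[of "int g" "int (g - 1)"] dvd_add_right_iff[of "int g" "int g" 1]
    by (auto simp: of_nat_diff algebra_simps)
  have "eichler g (e_vec g i) (f_vec g (i + int (g - 1) + 2)) \<in> H"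
    using eichler_two_steps[OF eichler_any_step dvd] genus by simp
  moreover have "i + int (g - 1) + 2 = (i + 1) + int g"
    using genus by (simp add: of_nat_diff)
  ultimately show ?thesis by (simp only: e_f_vec_add_period)
qed

lemma eichler_e_f_in:
  assumes "\<not> int g dvd i - j"
  shows "eichler g (e_vec g i) (f_vec g j) \<in> H"
proof -
  define d where "d = nat ((j - i) mod int g)"
  have dg: "d < g" unfolding d_def by (rule nat_mod_less)
  have d: "int d = (j - i) mod int g" using genus by (simp add: d_def)
  have "d \<noteq> 0"
    using assms d by (metis dvd_diff_commute mod_0_imp_dvd of_nat_0)
  then have "eichler g (e_vec g i) (f_vec g (i + int d)) \<in> H"
    using eichler_any_step[OF _ dg] eichler_one_step by (cases "d = 1") auto
  moreover have "f_vec g (i + int d) = f_vec g j"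
    by (simp add: f_vec_def d mod_simps)
  ultimately show ?thesis by simp
qed

text \<open>The Eichler factor of \<open>second_generator g n (i - 4)\<close> is now in
  \<open>H\<close>, so it can be cancelled from that generator.\<close>

lemma handle_matrix_in: "handle_matrix g n i \<in> H"
  using cancel_left[OF eichler_one_step[of "i - 4"], of "handle_matrix g n i"]
    second_generator_in[of "i - 4"] handle_matrix_Sp by (simp add: second_generator_def)

text \<open>The local matrix of handle \<open>j\<close> turns \<open>f_vec g j\<close> into
  \<open>- e_vec g j\<close> and fixes handle \<open>i\<close>.\<close>

lemma eichler_e_e_in:
  assumes "\<not> int g dvd i - j"
  shows "eichler g (e_vec g i) (e_vec g j) \<in> H"
proof -
  have "eichler g (e_vec g i) (- e_vec g j) \<in> H"
    using eichler_conj_in[OF handle_matrix_in[of j], of "e_vec g i" "f_vec g j"] eichler_e_f_in[of i j] assms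
    by simp
  then show ?thesis using eichler_uminus_in[of "e_vec g i" "- e_vec g j"] by simp
qed

lemma eichler_f_f_in:
  assumes "\<not> int g dvd i - j"
  shows "eichler g (f_vec g i) (f_vec g j) \<in> H"
proof -
  have "\<not> int g dvd j - i" using assms by (metis dvd_diff_commute)
  then show ?thesis
    using eichler_conj_inv_in[OF handle_matrix_in[of i], of "f_vec g i" "f_vec g j"]
      eichler_uminus_in[of "e_vec g i" "f_vec g j"] eichler_e_f_in[of i j] assms
    by (simp add: eichler_uminus_uminus)
qed

text \<open>Here \<open>n\<close> has to be odd: for even \<open>n\<close> both generators preserve the quadratic form
  \<open>\<Sum>i. x\<^sub>i * y\<^sub>i\<close> modulo 2.\<close>

lemma transvection_e_in: "transvection g 1 (e_vec g i) \<in> H"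
proof -
  let ?p = "e_vec g i" and ?a = "e_vec g (i + 1)" and ?b = "f_vec g (i + 1)"
  have a: "eichler g ?p ?a \<in> H" and b: "eichler g ?p ?b \<in> H"
    using eichler_e_e_in[of i "i + 1"] eichler_one_step by auto
  have T: "transvection g k ?p \<in> carrier (Sp_int g)" for k by (simp add: transvection_Sp)
  \<comment> \<open>The two orders of multiplication have opposite central terms, and their quotient
    is the transvection with factor 2.\<close>
  have "eichler g ?p ?a * eichler g ?p ?b = eichler g ?p (?a + ?b) * transvection g (- 1) ?p"
    using eichler_add[of ?p g ?a ?b] by simp
  moreover have "eichler g ?p ?b * eichler g ?p ?a = eichler g ?p (?a + ?b) * transvection g 1 ?p"
    using eichler_add[of ?p g ?b ?a] by (simp add: comm_add_vec[of ?b "2 * g" ?a])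
  moreover have "transvection g 1 ?p = transvection g (- 1) ?p * transvection g 2 ?p"
    by (simp add: transvection_add)
  ultimately have "(eichler g ?p ?a * eichler g ?p ?b) * transvection g 2 ?p = eichler g ?p ?b * eichler g ?p ?a"
    by (simp add: square_assoc[of _ g])
  then have two: "transvection g 2 ?p \<in> H"
    using cancel_left[OF mult_in[OF a b] _ T[of 2]] mult_in[OF b a] by simp
  \<comment> \<open>The local matrix sends \<open>?a\<close> to
    \<open>n \<cdot>\<^sub>v ?a + ?b\<close> in one stroke; building the same vector by
    \<open>eichler_add\<close> costs the central term \<open>- n\<close>.\<close>
  have "eichler g ?p (n \<cdot>\<^sub>v ?a + ?b) \<in> H"
    using eichler_conj_in[OF handle_matrix_in[of "i + 1"], of ?p ?a] a by simp
  moreover have "eichler g ?p (n \<cdot>\<^sub>v ?a) * eichler g ?p ?b =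
      eichler g ?p (n \<cdot>\<^sub>v ?a + ?b) * transvection g (- n) ?p"
    using eichler_add[of ?p g "n \<cdot>\<^sub>v ?a" ?b] by simp
  moreover have "eichler g ?p (n \<cdot>\<^sub>v ?a) \<in> H"
    using a by (intro eichler_multiple_in) auto
  ultimately have minus_n: "transvection g (- n) ?p \<in> H"
    using cancel_left[OF _ _ T[of "- n"]] mult_in[OF _ b] by metis
  obtain m where "n = 2 * m + 1" using odd by (rule oddE)
  \<comment> \<open>For \<open>n = 2 * m + 1\<close> one has
    \<open>(m + 1) * 2 - n = 1\<close>.\<close>
  then have "transvection g 1 ?p = transvection g ((m + 1) * 2) ?p * transvection g (- n) ?p"
    by (simp add: transvection_add)
  then show ?thesis
    using mult_in[OF transvection_multiple_in[OF _ two, of "m + 1"] minus_n] by simp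
qed

lemma transvection_f_in: "transvection g 1 (f_vec g i) \<in> H"
  using transvection_conj_inv_in[OF handle_matrix_in[of i], of "f_vec g i" 1] transvection_e_in[of i]
  by (simp add: transvection_uminus)

sublocale elementary_subgroup
proof
  fix i assume "i < 2 * g"
  then show "transvection g 1 (unit_vec (2 * g) i) \<in> H"
    by (simp add: unit_vec_handle transvection_e_in transvection_f_in)
next
  fix i j assume ij: "i < 2 * g" "j < 2 * g" "i mod g \<noteq> j mod g"
  define a b where "a = i mod g" and "b = j mod g"
  have "\<not> int g dvd int a - int b" "\<not> int g dvd int b - int a"
    using ij genus by (auto simp: a_def b_def mod_eq_dvd_iff[symmetric] zmod_int[symmetric])
  moreover have "unit_vec (2 * g) i = (if i < g then e_vec g (int a) else f_vec g (int a))"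
    "unit_vec (2 * g) j = (if j < g then e_vec g (int b) else f_vec g (int b))"
    using ij by (auto simp: unit_vec_handle a_def b_def mod_if)
  ultimately show "eichler g (unit_vec (2 * g) i) (unit_vec (2 * g) j) \<in> H"
    using eichler_commute[of "f_vec g (int a)" g "e_vec g (int b)"]
    by (simp add: eichler_e_e_in eichler_e_f_in eichler_f_f_in)
qed

end

context genus
begin

lemma generate_eq:
  assumes "odd n"
  shows "generate (Sp_int g) {handle_shift g, second_generator g n 0} = carrier (Sp_int g)"
proof -
  interpret G: group "Sp_int g" by (rule Sp_int_group)
  interpret two_generators g "generate (Sp_int g) {handle_shift g, second_generator g n 0}" n
  proof (intro two_generators.intro genus_axioms Sp_subgroup.intro two_generators_axioms.intro)
    show "subgroup (generate (Sp_int g) {handle_shift g, second_generator g n 0}) (Sp_int g)"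
      using handle_shift_Sp second_generator_Sp by (intro G.generate_is_subgroup) auto
  qed (use assms in \<open>auto intro: generate.incl\<close>)
  show ?thesis by (rule eq_Sp)
qed

end

section \<open>The commutator invariant\<close>

definition commutator :: "('a, 'b) monoid_scheme \<Rightarrow> 'a \<Rightarrow> 'a \<Rightarrow> 'a" where
  "commutator G a b = a \<otimes>\<^bsub>G\<^esub> b \<otimes>\<^bsub>G\<^esub> inv\<^bsub>G\<^esub> a \<otimes>\<^bsub>G\<^esub> inv\<^bsub>G\<^esub> b"

context group
begin

lemma commutator_closed:
  "a \<in> carrier G \<Longrightarrow> b \<in> carrier G \<Longrightarrow> commutator G a b \<in> carrier G"
  by (simp add: commutator_def)

lemma inv_commutator:
  "a \<in> carrier G \<Longrightarrow> b \<in> carrier G \<Longrightarrow> inv (commutator G a b) = commutator G b a"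
  by (simp add: commutator_def inv_mult_group m_assoc)

lemma commutator_inv_left:
  assumes "a \<in> carrier G" "b \<in> carrier G"
  shows "commutator G (inv a) b = inv a \<otimes> (commutator G b a \<otimes> a)"
  using assms by (simp add: commutator_def m_assoc)

lemma commutator_mult_left:
  assumes "a \<in> carrier G" "b \<in> carrier G"
  shows "commutator G (a \<otimes> b) b = commutator G a b"
proof -
  have "b \<otimes> (inv b \<otimes> (inv a \<otimes> inv b)) = inv a \<otimes> inv b"
    using assms by (simp add: m_assoc[symmetric])
  then show ?thesis
    using assms by (simp add: commutator_def inv_mult_group m_assoc)
qed

text \<open>A swap inverts the commutator, multiplication in the left entry keeps it, and inversion
  there conjugates its inverse. The rules for the right entry follow by swapping.\<close>

lemma class_function_commutator_invariant:
  fixes \<chi> :: "'a \<Rightarrow> 'c"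
  assumes comm: "\<And>a b. a \<in> carrier G \<Longrightarrow> b \<in> carrier G \<Longrightarrow> \<chi> (a \<otimes> b) = \<chi> (b \<otimes> a)"
    and inv: "\<And>a. a \<in> carrier G \<Longrightarrow> \<chi> (inv a) = \<chi> a"
    and equiv: "nielsen_equivalent G [a, b] [c, d]"
    and ab: "a \<in> carrier G" "b \<in> carrier G"
  shows "\<chi> (commutator G a b) = \<chi> (commutator G c d)"
proof -
  have flip: "\<chi> (commutator G y x) = \<chi> (commutator G x y)" if "x \<in> carrier G" "y \<in> carrier G" for x y
    using inv[of "commutator G x y"] that by (simp add: inv_commutator commutator_closed)
  have left: "\<chi> (commutator G (inv x) y) = \<chi> (commutator G x y)" if "x \<in> carrier G" "y \<in> carrier G" for x y
    using that comm[of "inv x" "commutator G y x \<otimes> x"] flip[of x y]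
    by (simp add: commutator_inv_left commutator_closed m_assoc)
  have right: "\<chi> (commutator G x (inv y)) = \<chi> (commutator G x y)" if "x \<in> carrier G" "y \<in> carrier G" for x y
    using that left[of y x] flip[of x y] flip[of x "inv y"] by simp
  have right_mult: "\<chi> (commutator G x (y \<otimes> x)) = \<chi> (commutator G x y)" if "x \<in> carrier G" "y \<in> carrier G" for x y
    using that flip[of x y] flip[of x "y \<otimes> x"] by (simp add: commutator_mult_left)
  \<comment> \<open>The shape of \<open>ys\<close> is recorded so that moves can be iterated along
    the closure.\<close>
  have move: "\<exists>x' y'. ys = [x', y'] \<and> x' \<in> carrier G \<and> y' \<in> carrier G
      \<and> \<chi> (commutator G x y) = \<chi> (commutator G x' y')"
    if "elementary_nielsen G [x, y] ys" "x \<in> carrier G" "y \<in> carrier G" for x y ys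
    using that(1)
  proof cases
    case (invert i)
    then consider "i = 0" | "i = 1" by fastforce
    then show ?thesis using invert that(2,3) left right by cases auto
  next
    case (swap i j)
    then consider "i = 0" "j = 1" | "i = 1" "j = 0" by fastforce
    then show ?thesis
      using swap that(2,3) flip
      by cases auto
  next
    case (mult i j)
    then consider "i = 0" "j = 1" | "i = 1" "j = 0" by fastforce
    then show ?thesis
      using mult that(2,3) right_mult
      by cases (auto simp: commutator_mult_left)
  qed
  have "\<exists>x y. ys = [x, y] \<and> x \<in> carrier G \<and> y \<in> carrier G \<and> \<chi> (commutator G a b) = \<chi> (commutator G x y)"
    if "(elementary_nielsen G)\<^sup>*\<^sup>* [a, b] ys" for ys
    using that
  proof (induction rule: rtranclp_induct)
    case base
    then show ?case using ab by blast
  next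
    case (step ys zs)
    then show ?case using move by metis
  qed
  then show ?thesis using equiv by (fastforce simp: nielsen_equivalent_def)
qed

end

section \<open>The commutator of the two generators and its trace\<close>

lemma square_add_vec:
  fixes A :: "int mat"
  assumes "A \<in> carrier_mat (2 * g) (2 * g)" "v \<in> carrier_vec (2 * g)" "w \<in> carrier_vec (2 * g)"
  shows "A *\<^sub>v (v + w) = A *\<^sub>v v + A *\<^sub>v w"
  using assms by (rule mult_add_distrib_mat_vec)

lemma square_uminus_vec:
  fixes A :: "int mat"
  assumes "A \<in> carrier_mat (2 * g) (2 * g)" "v \<in> carrier_vec (2 * g)"
  shows "A *\<^sub>v (- v) = - (A *\<^sub>v v)"
  using assms by (intro eq_vecI) auto

context genus
begin

text \<open>The block with rows \<open>(0, 1)\<close> and \<open>(-1, n)\<close> in the basis of the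
  handle.\<close>

definition handle_matrix_inverse :: "int \<Rightarrow> int \<Rightarrow> int mat" where
  "handle_matrix_inverse n i = rank2 g (e_vec g i) (f_vec g i) (- 1) (- 1) (1 - n) (- 1)"

lemma handle_matrix_inverse_carrier_mat [simp]:
  "handle_matrix_inverse n i \<in> carrier_mat (2 * g) (2 * g)"
  by (simp add: handle_matrix_inverse_def)

lemma handle_matrix_inverse_mult: "handle_matrix_inverse n i * handle_matrix g n i = 1\<^sub>m (2 * g)"
proof (rule mat_eq_on_vecI[of _ "2 * g"])
  fix v :: "int vec" assume v: "v \<in> carrier_vec (2 * g)"
  then show "(handle_matrix_inverse n i * handle_matrix g n i) *\<^sub>v v = 1\<^sub>m (2 * g) *\<^sub>v v"
    by (intro eq_vecI) (auto simp: handle_matrix_inverse_def handle_matrix_def square_vec_assoc[of _ g]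
        rank2_mult_vec ring_distribs simp del: index_mult_mat_vec)
qed (use Sp_int_carrier_mat[OF handle_matrix_Sp] in auto)

lemma handle_matrix_inverse_e_f [simp]:
  "handle_matrix_inverse n i *\<^sub>v e_vec g i = - f_vec g i"
  "handle_matrix_inverse n i *\<^sub>v f_vec g i = e_vec g i + n \<cdot>\<^sub>v f_vec g i"
  unfolding handle_matrix_inverse_def
  by (intro eq_vecI; simp add: rank2_mult_vec ring_distribs del: index_mult_mat_vec)+

lemma handle_matrix_inverse_other [simp]:
  assumes "\<not> int g dvd j - i"
  shows "handle_matrix_inverse n i *\<^sub>v e_vec g j = e_vec g j"
    "handle_matrix_inverse n i *\<^sub>v f_vec g j = f_vec g j"
  using assms unfolding handle_matrix_inverse_def by (auto simp: rank2_mult_vec)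

lemma eichler_uminus_handle_e [simp]:
  "eichler g (e_vec g i) (- f_vec g j) *\<^sub>v e_vec g k =
    (if int g dvd k - j then e_vec g k + - e_vec g i else e_vec g k)"
  by (auto simp: eichler_mult_vec)

lemma eichler_uminus_handle_f [simp]:
  "eichler g (e_vec g i) (- f_vec g j) *\<^sub>v f_vec g k =
    (if int g dvd k - i then f_vec g k + f_vec g j else f_vec g k)"
  by (auto simp: eichler_mult_vec)

lemma inv_second_generator:
  "inv\<^bsub>Sp_int g\<^esub> (second_generator g n 0) =
    handle_matrix_inverse n 4 * eichler g (e_vec g 0) (- f_vec g 1)"
proof -
  interpret G: group "Sp_int g" by (rule Sp_int_group)
  let ?E = "eichler g (e_vec g 0) (f_vec g 1)" and ?E' = "eichler g (e_vec g 0) (- f_vec g 1)"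
    and ?L = "handle_matrix g n 4" and ?L' = "handle_matrix_inverse n 4"
  note L = Sp_int_carrier_mat[OF handle_matrix_Sp, of n 4]
  have "?E' * ?E = eichler g (e_vec g 0) (- f_vec g 1 + f_vec g 1)"
    by (rule eichler_add_orthogonal) auto
  also have "- f_vec g 1 + f_vec g 1 = 0\<^sub>v (2 * g)" by (intro eq_vecI) auto
  also have "eichler g (e_vec g 0) (0\<^sub>v (2 * g)) = 1\<^sub>m (2 * g)" by (rule eichler_zero) simp
  finally have E: "?E' * ?E = 1\<^sub>m (2 * g)" .
  have "(?L' * ?E') * (?E * ?L) = ?L' * ((?E' * ?E) * ?L)"
    using L by (simp add: square_assoc[of _ g])
  then have *: "(?L' * ?E') * second_generator g n 0 = 1\<^sub>m (2 * g)"
    using E L handle_matrix_inverse_mult by (simp add: second_generator_def)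
  have "?L' \<in> carrier (Sp_int g)"
    unfolding handle_matrix_inverse_def by (intro rank2_Sp) auto
  moreover have "?E' \<in> carrier (Sp_int g)" by (intro eichler_Sp) auto
  ultimately show ?thesis
    using G.inv_equality[of "?L' * ?E'" "second_generator g n 0"] * second_generator_Sp
      G.m_closed[of ?L' ?E'] by simp
qed

lemma dvd_diff_iff:
  assumes "k < g" "c < g"
  shows "int g dvd int k - int c \<longleftrightarrow> k = c"
  using assms by (simp add: mod_eq_dvd_iff[symmetric] zmod_int[symmetric])

text \<open>Conjugating the second generator by the shift gives
  \<open>second_generator g n 1\<close>, which is then multiplied by the inverse of the
  original.\<close>

lemma commutator_generators:
  "commutator (Sp_int g) (handle_shift g) (second_generator g n 0) =
    second_generator g n 1 * (handle_matrix_inverse n 4 * eichler g (e_vec g 0) (- f_vec g 1))"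
proof -
  interpret G: group "Sp_int g" by (rule Sp_int_group)
  let ?x = "handle_shift g" and ?y = "second_generator g n 0" and ?z = "second_generator g n 1"
  have "?x \<otimes>\<^bsub>Sp_int g\<^esub> ?y = ?z \<otimes>\<^bsub>Sp_int g\<^esub> ?x"
    using handle_shift_conj[of n 0] by simp
  then have "commutator (Sp_int g) ?x ?y = ?z \<otimes>\<^bsub>Sp_int g\<^esub> inv\<^bsub>Sp_int g\<^esub> ?y"
    using handle_shift_Sp second_generator_Sp
    by (simp add: commutator_def G.m_assoc del: Sp_int_simps)
  then show ?thesis by (simp add: inv_second_generator)
qed

text \<open>Pairing with the dual basis vector reads off diagonal entries; the minus sign is that of
  \<open>omega g (f_vec g i) (e_vec g i)\<close>.\<close>

lemma trace_handles:
  assumes A: "A \<in> carrier_mat (2 * g) (2 * g)"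
  shows "trace A = (\<Sum>k<g. omega g (A *\<^sub>v e_vec g (int k)) (f_vec g (int k))
    - omega g (A *\<^sub>v f_vec g (int k)) (e_vec g (int k)))"
proof -
  have shift: "(\<Sum>i<2 * g. h i) = (\<Sum>k<g. h k + h (g + k))" for h :: "nat \<Rightarrow> int"
  proof -
    have "{..<2 * g} = {0..<g} \<union> {g..<2 * g}" by auto
    then have "(\<Sum>i<2 * g. h i) = (\<Sum>i\<in>{0..<g}. h i) + (\<Sum>i\<in>{g..<2 * g}. h i)"
      by (simp add: sum.union_disjoint)
    also have "(\<Sum>i\<in>{g..<2 * g}. h i) = (\<Sum>i\<in>{0..<g}. h (g + i))"
      using sum.shift_bounds_nat_ivl[of h 0 g g] by (simp add: mult_2 add.commute)
    finally show ?thesis by (simp add: sum.distrib lessThan_atLeast0)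
  qed
  have "A $$ (k, k) = omega g (A *\<^sub>v e_vec g (int k)) (f_vec g (int k))"
    "A $$ (g + k, g + k) = - omega g (A *\<^sub>v f_vec g (int k)) (e_vec g (int k))" if "k < g" for k
    using A that by (simp_all add: e_vec_def f_vec_def zmod_int[symmetric] omega_unit_right)
  then show ?thesis
    using A by (simp add: trace_def shift)
qed

text \<open>The Eichler factors add nothing to the diagonal. Each handle contributes 2, except
  handles 4 and 5, whose blocks have trace \<open>n\<close>.\<close>

lemma trace_commutator_generators:
  "trace (commutator (Sp_int g) (handle_shift g) (second_generator g n 0)) = 2 * int g + 2 * n - 4"
proof -
  let ?M = "commutator (Sp_int g) (handle_shift g) (second_generator g n 0)"
  note y = Sp_int_carrier_mat[OF second_generator_Sp]
  note E = eichler_carrier_mat and L = Sp_int_carrier_mat[OF handle_matrix_Sp]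
  have M: "?M \<in> carrier_mat (2 * g) (2 * g)"
    unfolding commutator_generators using y by simp
  have Mv: "?M *\<^sub>v v = eichler g (e_vec g 1) (f_vec g 2) *\<^sub>v (handle_matrix g n 5 *\<^sub>v
      (handle_matrix_inverse n 4 *\<^sub>v (eichler g (e_vec g 0) (- f_vec g 1) *\<^sub>v v)))"
    if "v \<in> carrier_vec (2 * g)" for v
    unfolding commutator_generators using y that
    by (simp add: square_vec_assoc[of _ g] second_generator_mult_vec)
  have diag: "omega g (?M *\<^sub>v e_vec g (int k)) (f_vec g (int k))
      - omega g (?M *\<^sub>v f_vec g (int k)) (e_vec g (int k))
      = 2 + ((if k = 4 then n - 2 else 0) + (if k = 5 then n - 2 else 0))" if k: "k < g" for k
  proof -
    \<comment> \<open>Handles 0, 1, 2 meet the Eichler factors and 4, 5 the local ones; the vectors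
      of every other handle are fixed.\<close>
    consider "k = 0" | "k = 1" | "k = 2" | "k = 4" | "k = 5"
      | "k \<noteq> 0" "k \<noteq> 1" "k \<noteq> 2" "k \<noteq> 4" "k \<noteq> 5" by blast
    then show ?thesis
    proof cases
      case 6
      then have "\<not> int g dvd int k - 0" "\<not> int g dvd int k - 1" "\<not> int g dvd int k - 2"
        "\<not> int g dvd int k - 4" "\<not> int g dvd int k - 5"
        using k genus dvd_diff_iff[OF k, of 0] dvd_diff_iff[OF k, of 1] dvd_diff_iff[OF k, of 2]
          dvd_diff_iff[OF k, of 4] dvd_diff_iff[OF k, of 5] by simp_all
      then show ?thesis using 6 by (simp add: Mv)
    qed (simp_all add: Mv square_add_vec[of _ g] square_uminus_vec[of _ g] square_smult_vec[of _ g] L)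
  qed
  have "trace ?M = (\<Sum>k<g. 2 + ((if k = 4 then n - 2 else 0) + (if k = 5 then n - 2 else 0)))"
    unfolding trace_handles[OF M] by (intro sum.cong) (auto simp: diag)
  also have "\<dots> = 2 * int g + 2 * n - 4"
    using genus by (simp add: sum.distrib)
  finally show ?thesis .
qed

lemma infinite_classes: "infinite (nielsen_classes_of_pairs (Sp_int g))"
proof
  assume fin: "finite (nielsen_classes_of_pairs (Sp_int g))"
  interpret G: group "Sp_int g" by (rule Sp_int_group)
  let ?R = "{(xs, ys). xs \<in> generating_pairs (Sp_int g) \<and> ys \<in> generating_pairs (Sp_int g)
    \<and> nielsen_equivalent (Sp_int g) xs ys}"
  \<comment> \<open>Odd parameters meet the hypothesis of \<open>generate_eq\<close>, and distinct
    ones give distinct traces.\<close>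
  define pair where "pair m = [handle_shift g, second_generator g (2 * int m + 1) 0]" for m :: nat
  have pair: "pair m \<in> generating_pairs (Sp_int g)" for m
    using handle_shift_Sp second_generator_Sp generate_eq[of "2 * int m + 1"]
    by (auto simp: pair_def generating_pairs_def)
  have "inj (\<lambda>m. ?R `` {pair m})"
  proof (rule injI)
    fix l m assume eq: "?R `` {pair l} = ?R `` {pair m}"
    \<comment> \<open>By reflexivity \<open>pair m\<close> lies in its own class, hence in that of
      \<open>pair l\<close>.\<close>
    have "nielsen_equivalent (Sp_int g) (pair m) (pair m)" by (simp add: nielsen_equivalent_def)
    then have "pair m \<in> ?R `` {pair l}" using pair eq by auto
    then have equiv: "nielsen_equivalent (Sp_int g) (pair l) (pair m)" by simp
    have "trace (commutator (Sp_int g) (handle_shift g) (second_generator g (2 * int l + 1) 0)) =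
        trace (commutator (Sp_int g) (handle_shift g) (second_generator g (2 * int m + 1) 0))"
    proof (rule G.class_function_commutator_invariant[where \<chi> = trace, OF _ trace_Sp_int_inv])
      fix A B assume "A \<in> carrier (Sp_int g)" "B \<in> carrier (Sp_int g)"
      then show "trace (A \<otimes>\<^bsub>Sp_int g\<^esub> B) = trace (B \<otimes>\<^bsub>Sp_int g\<^esub> A)"
        using trace_mult_comm[of A "2 * g" B] Sp_int_carrier_mat by simp
    qed (use equiv handle_shift_Sp second_generator_Sp in \<open>simp_all add: pair_def\<close>)
    then show "l = m" by (simp add: trace_commutator_generators)
  qed
  then have "infinite (range (\<lambda>m. ?R `` {pair m}))" by (rule range_inj_infinite)
  moreover have "range (\<lambda>m. ?R `` {pair m}) \<subseteq> nielsen_classes_of_pairs (Sp_int g)"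
    using pair unfolding nielsen_classes_of_pairs_def by (blast intro: quotientI)
  ultimately show False using fin finite_subset by blast
qed

end

theorem corollary1p2:
  fixes g :: nat
  assumes "g \<ge> 8"
  shows "infinite (nielsen_classes_of_pairs (Sp_int g))"
  using assms by (intro genus.infinite_classes genus.intro)

end
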